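(* Let $n\in\omega+1$. Then there exists a map $u_n:\mathcal{P}(\omega^\omega)\to\mathcal{P}(\omega^\omega)$ such that for every $m\leq n$, the map $u_{n,m}:\mathcal{M}_n\to\mathcal{M}_m$ induced by $u_n$ (sending the $n$-degree of $\mathcal{A}$ to the $m$-degree of $u_n(\mathcal{A})$) is a well-defined embedding preserving joins and implications. Furthermore, $u_n(\mathcal{A})\equiv_n\mathcal{A}$ for all $\mathcal{A}\subseteq\omega^\omega$.
   Context: A mass problem is a subset of $\omega^\omega$. $\Phi_e$ is the Turing functional with index $e$; writing $\Phi_e(f)\in\mathcal{A}$ means in particular that $\Phi_e(f)$ is total. $\Pi^0_n$-classes are the effective (lightface) $\Pi^0_n$ subsets of $\omega^\omega$; a sequence of classes is uniformly $\Pi^0_n$ if it has a computable sequence of $\Pi^0_n$-indices. For $n=0$, $\Pi^0_0$-classes are finite Boolean combinations of cylinders $\{f \mid \sigma\subset f\}$, $\sigma\in\omega^{<\omega}$. For $n\in\omega$ and $\mathcal{A},\mathcal{B}\subseteq\omega^\omega$, $\mathcal{A}\leq_n\mathcal{B}$ means: there are a uniformly $\Pi^0_n$ sequence $\mathcal{V}_0,\mathcal{V}_1,\dots$ with $\mathcal{B}\subseteq\bigcup_i\mathcal{V}_i$ and a computable sequence $e_0,e_1,\dots$ such that for every $i$ and every $f\in\mathcal{B}\cap\mathcal{V}_i$ we have $\Phi_{e_i}(f)\in\mathcal{A}$. $\leq_\omega$ denotes Muchnik reducibility: $\mathcal{A}\leq_\omega\mathcal{B}$ iff every $f\in\mathcal{B}$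 computes some $g\in\mathcal{A}$. For $n\in\omega+1$, $\equiv_n$ is the induced equivalence and $\mathcal{M}_n=\mathcal{P}(\omega^\omega)/{\equiv_n}$, ordered by $\leq_n$. Each $\mathcal{M}_n$ is a Brouwer algebra: a bounded distributive lattice with join $\oplus$ (induced by $\mathcal{A}\oplus\mathcal{B}=\{f\oplus g\mid f\in\mathcal{A},g\in\mathcal{B}\}$), meet $\otimes$, and an implication $\to$ such that $a\oplus c\geq b$ iff $c\geq a\to b$. A map on $\mathcal{P}(\omega^\omega)$ induces a well-defined map $\mathcal{M}_n\to\mathcal{M}_m$ if it sends $n$-equivalent sets to $m$-equivalent sets. An embedding is an injective map that preserves and reflects the order. *)

theory Defs
  imports "HOL-Library.Nat_Bijection" "HOL-Library.Extended_Nat"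
begin

section \<open>Turing functionals\<close>

text \<open>
  Oracle programs for the partial recursive functions relative to an oracle \<open>f\<close>.  All functions
  are unary; several arguments are passed through the bijection \<^const>\<open>prod_encode\<close>.
\<close>

datatype code =
    Zero
  | Succ
  | Left
  | Right
  | Oracle
  | Pair code code
  | Comp code code
  | Prec code code
  | Mu code

text \<open>
  \<open>Prec p q\<close> is primitive recursion with parameter \<open>a\<close> on \<open>k\<close> for the input \<open>(a, k)\<close>: the step
  function \<open>q\<close> receives \<open>(a, (k, r))\<close> with \<open>r\<close> the value at \<open>k\<close>.  \<open>Mu p\<close> is unbounded search; it
  converges only if \<open>p\<close> converges on all candidates up to and including the one found.
\<close>

primrec eval :: "code \<Rightarrow> (nat \<Rightarrow> nat) \<Rightarrow> nat \<Rightarrow> nat option" where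
  "eval Zero f x = Some 0"
| "eval Succ f x = Some (Suc x)"
| "eval Left f x = Some (fst (prod_decode x))"
| "eval Right f x = Some (snd (prod_decode x))"
| "eval Oracle f x = Some (f x)"
| "eval (Pair p q) f x =
     Option.bind (eval p f x) (\<lambda>a. Option.bind (eval q f x) (\<lambda>b. Some (prod_encode (a, b))))"
| "eval (Comp p q) f x = Option.bind (eval q f x) (eval p f)"
| "eval (Prec p q) f x =
     rec_nat (eval p f (fst (prod_decode x)))
       (\<lambda>k v. Option.bind v
          (\<lambda>r. eval q f (prod_encode (fst (prod_decode x), prod_encode (k, r)))))
       (snd (prod_decode x))"
| "eval (Mu p) f x =
     (if \<exists>k. eval p f (prod_encode (x, k)) = Some 0 \<and>
             (\<forall>j<k. eval p f (prod_encode (x, j)) \<noteq> None)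
      then Some (LEAST k. eval p f (prod_encode (x, k)) = Some 0)
      else None)"

text \<open>The program with a given number; every number is the index of a program.\<close>

function code_of :: "nat \<Rightarrow> code" where
  "code_of e =
     (if e = 0 then Zero
      else if e = 1 then Succ
      else if e = 2 then Left
      else if e = 3 then Right
      else if e = 4 then Oracle
      else if (e - 5) mod 4 = 0 then
        Pair (code_of (fst (prod_decode ((e - 5) div 4))))
             (code_of (snd (prod_decode ((e - 5) div 4))))
      else if (e - 5) mod 4 = 1 then
        Comp (code_of (fst (prod_decode ((e - 5) div 4))))
             (code_of (snd (prod_decode ((e - 5) div 4))))
      else if (e - 5) mod 4 = 2 then
        Prec (code_of (fst (prod_decode ((e - 5) div 4))))
             (code_of (snd (prod_decode ((e - 5) div 4))))
      else Mu (code_of ((e - 5) div 4)))"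
  by pat_completeness auto

lemma fst_prod_decode_le: "fst (prod_decode k) \<le> k"
  by (metis le_prod_encode_1 prod.collapse prod_decode_inverse)

lemma snd_prod_decode_le: "snd (prod_decode k) \<le> k"
  by (metis le_prod_encode_2 prod.collapse prod_decode_inverse)

termination code_of
proof -
  have *: "(e - 5) div 4 < e" "fst (prod_decode ((e - 5) div 4)) < e"
    "snd (prod_decode ((e - 5) div 4)) < e" if "e \<noteq> 0" for e :: nat
    using that fst_prod_decode_le[of "(e - 5) div 4"] snd_prod_decode_le[of "(e - 5) div 4"]
    by linarith+
  show ?thesis
    by (relation "measure id") (use * in simp_all)
qed

declare code_of.simps [simp del]

text \<open>\<open>Phi e f\<close> is the partial function \<open>\<Phi>\<^sub>e(f)\<close>.\<close>

definition Phi :: "nat \<Rightarrow> (nat \<Rightarrow> nat) \<Rightarrow> nat \<Rightarrow> nat option" where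
  "Phi e f = eval (code_of e) f"

text \<open>\<open>\<Phi>\<^sub>e(f) \<in> \<A>\<close>, which includes that \<open>\<Phi>\<^sub>e(f)\<close> is total.\<close>

definition Phi_in :: "nat \<Rightarrow> (nat \<Rightarrow> nat) \<Rightarrow> (nat \<Rightarrow> nat) set \<Rightarrow> bool" where
  "Phi_in e f A \<longleftrightarrow> (\<exists>g\<in>A. \<forall>x. Phi e f x = Some (g x))"

text \<open>Plain computability is computability relative to the constant zero oracle.\<close>

definition phi :: "nat \<Rightarrow> nat \<Rightarrow> nat option" where
  "phi e = Phi e (\<lambda>_. 0)"

definition computable :: "(nat \<Rightarrow> nat) \<Rightarrow> bool" where
  "computable g \<longleftrightarrow> (\<exists>e. \<forall>x. phi e x = Some (g x))"


section \<open>Effective classes\<close>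

definition cylinder :: "nat list \<Rightarrow> (nat \<Rightarrow> nat) set" where
  "cylinder \<sigma> = {f. \<forall>i<length \<sigma>. f i = \<sigma> ! i}"

text \<open>
  The finite Boolean combination of cylinders with a given index: the remainder modulo 3 says
  whether the index stands for a cylinder, a complement or an intersection.
\<close>

function Pi0_class :: "nat \<Rightarrow> (nat \<Rightarrow> nat) set" where
  "Pi0_class e =
     (if e mod 3 = 0 then cylinder (list_decode (e div 3))
      else if e mod 3 = 1 then - Pi0_class (e div 3)
      else Pi0_class (fst (prod_decode (e div 3))) \<inter> Pi0_class (snd (prod_decode (e div 3))))"
  by pat_completeness auto

termination Pi0_class
proof -
  have *: "e div 3 < e" "fst (prod_decode (e div 3)) < e" "snd (prod_decode (e div 3)) < e"
    if "e mod 3 \<noteq> 0" for e :: nat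
  proof -
    from that have "e > 0" by (cases e) auto
    then show "e div 3 < e" by simp
    then show "fst (prod_decode (e div 3)) < e" "snd (prod_decode (e div 3)) < e"
      using fst_prod_decode_le[of "e div 3"] snd_prod_decode_le[of "e div 3"] by linarith+
  qed
  show ?thesis
    by (relation "measure id") (use * in simp_all)
qed

declare Pi0_class.simps [simp del]

text \<open>
  \<open>Pi_index n e V\<close>: \<open>e\<close> is a \<open>\<Pi>\<^sup>0\<^sub>n\<close>-index of \<open>V\<close>.  An index at level \<open>n + 1\<close> is an index of a total
  computable function listing \<open>\<Pi>\<^sup>0\<^sub>n\<close>-indices; it denotes the intersection of the complements, i.e.
  an effective intersection of \<open>\<Sigma>\<^sup>0\<^sub>n\<close>-classes.
\<close>

primrec Pi_index :: "nat \<Rightarrow> nat \<Rightarrow> (nat \<Rightarrow> nat) set \<Rightarrow> bool" where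
  "Pi_index 0 e V \<longleftrightarrow> V = Pi0_class e"
| "Pi_index (Suc n) e V \<longleftrightarrow>
     (\<exists>h W. (\<forall>j. phi e j = Some (h j)) \<and> (\<forall>j. Pi_index n (h j) (W j)) \<and> V = (\<Inter>j. - W j))"

definition uniformly_Pi :: "nat \<Rightarrow> (nat \<Rightarrow> (nat \<Rightarrow> nat) set) \<Rightarrow> bool" where
  "uniformly_Pi n V \<longleftrightarrow> (\<exists>h. computable h \<and> (\<forall>i. Pi_index n (h i) (V i)))"


section \<open>Reducibilities and degrees\<close>

text \<open>\<open>red n A B\<close> is \<open>A \<le>\<^sub>n B\<close>; the ordinal \<open>\<omega>\<close> is represented by \<open>\<infinity>\<close>.\<close>

definition red :: "enat \<Rightarrow> (nat \<Rightarrow> nat) set \<Rightarrow> (nat \<Rightarrow> nat) set \<Rightarrow> bool" where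
  "red n A B \<longleftrightarrow>
     (case n of
        enat k \<Rightarrow>
          \<exists>V e. uniformly_Pi k V \<and> B \<subseteq> (\<Union>i. V i) \<and> computable e \<and>
                (\<forall>i. \<forall>f\<in>B \<inter> V i. Phi_in (e i) f A)
      | \<infinity> \<Rightarrow> \<forall>f\<in>B. \<exists>e. Phi_in e f A)"

definition equivalent :: "enat \<Rightarrow> (nat \<Rightarrow> nat) set \<Rightarrow> (nat \<Rightarrow> nat) set \<Rightarrow> bool" where
  "equivalent n A B \<longleftrightarrow> red n A B \<and> red n B A"

definition equiv_rel :: "enat \<Rightarrow> ((nat \<Rightarrow> nat) set \<times> (nat \<Rightarrow> nat) set) set" where
  "equiv_rel n = {(A, B). equivalent n A B}"

type_synonym degree = "(nat \<Rightarrow> nat) set set"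

definition deg :: "enat \<Rightarrow> (nat \<Rightarrow> nat) set \<Rightarrow> degree" where
  "deg n A = equiv_rel n `` {A}"

definition degrees :: "enat \<Rightarrow> degree set" where
  "degrees n = UNIV // equiv_rel n"

definition deg_le :: "enat \<Rightarrow> degree \<Rightarrow> degree \<Rightarrow> bool" where
  "deg_le n a b \<longleftrightarrow> (\<exists>A\<in>a. \<exists>B\<in>b. red n A B)"

definition fun_join :: "(nat \<Rightarrow> nat) \<Rightarrow> (nat \<Rightarrow> nat) \<Rightarrow> nat \<Rightarrow> nat" where
  "fun_join f g x = (if even x then f (x div 2) else g (x div 2))"

definition mass_join :: "(nat \<Rightarrow> nat) set \<Rightarrow> (nat \<Rightarrow> nat) set \<Rightarrow> (nat \<Rightarrow> nat) set" where
  "mass_join A B = {fun_join f g | f g. f \<in> A \<and> g \<in> B}"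

text \<open>
  On degrees the union ranges over the representatives; all of them contribute the same degree.
\<close>

definition deg_join :: "enat \<Rightarrow> degree \<Rightarrow> degree \<Rightarrow> degree" where
  "deg_join n a b = (\<Union>A\<in>a. \<Union>B\<in>b. deg n (mass_join A B))"

text \<open>The implication \<open>a \<rightarrow> b\<close> of the Brouwer algebra: \<open>a \<oplus> c \<ge> b\<close> iff \<open>c \<ge> (a \<rightarrow> b)\<close>.\<close>

definition deg_imp :: "enat \<Rightarrow> degree \<Rightarrow> degree \<Rightarrow> degree" where
  "deg_imp n a b =
     (THE d. d \<in> degrees n \<and>
        (\<forall>c\<in>degrees n. deg_le n b (deg_join n a c) \<longleftrightarrow> deg_le n d c))"


section \<open>Induced maps\<close>

definition induces_map ::
  "enat \<Rightarrow> enat \<Rightarrow> ((nat \<Rightarrow> nat) set \<Rightarrow> (nat \<Rightarrow> nat) set) \<Rightarrow> bool" where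
  "induces_map n m u \<longleftrightarrow> (\<forall>A B. equivalent n A B \<longrightarrow> equivalent m (u A) (u B))"

text \<open>Meaningful only under \<^const>\<open>induces_map\<close>; then it sends \<open>deg n A\<close> to \<open>deg m (u A)\<close>.\<close>

definition induced_map ::
  "enat \<Rightarrow> enat \<Rightarrow> ((nat \<Rightarrow> nat) set \<Rightarrow> (nat \<Rightarrow> nat) set) \<Rightarrow> degree \<Rightarrow> degree" where
  "induced_map n m u a = (\<Union>A\<in>a. deg m (u A))"

definition embedding :: "enat \<Rightarrow> enat \<Rightarrow> (degree \<Rightarrow> degree) \<Rightarrow> bool" where
  "embedding n m \<phi> \<longleftrightarrow>
     \<phi> ` degrees n \<subseteq> degrees m \<and> inj_on \<phi> (degrees n) \<and>
     (\<forall>a\<in>degrees n. \<forall>b\<in>degrees n. deg_le n a b \<longleftrightarrow> deg_le m (\<phi> a) (\<phi> b))"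

definition preserves_joins :: "enat \<Rightarrow> enat \<Rightarrow> (degree \<Rightarrow> degree) \<Rightarrow> bool" where
  "preserves_joins n m \<phi> \<longleftrightarrow>
     (\<forall>a\<in>degrees n. \<forall>b\<in>degrees n. \<phi> (deg_join n a b) = deg_join m (\<phi> a) (\<phi> b))"

definition preserves_implications :: "enat \<Rightarrow> enat \<Rightarrow> (degree \<Rightarrow> degree) \<Rightarrow> bool" where
  "preserves_implications n m \<phi> \<longleftrightarrow>
     (\<forall>a\<in>degrees n. \<forall>b\<in>degrees n. \<phi> (deg_imp n a b) = deg_imp m (\<phi> a) (\<phi> b))"

end

theory Submission
  imports Defs
begin

text \<open>
  For finite \<open>n\<close>, \<open>\<A> \<le>\<^sub>n \<B>\<close> holds iff a single index \<open>r\<close> reduces every \<open>f \<in> \<B>\<close> to \<open>\<A>\<close>, where \<open>r\<close>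
  describes a countable cover by \<open>\<Pi>\<^sup>0\<^sub>n\<close>-conditions together with the functionals to be applied on the pieces.
  Let \<open>u\<^sub>n(\<A>)\<close> be the set of all \<open>r\<close> followed by \<open>f\<close> such that \<open>r\<close> reduces \<open>f\<close> to \<open>\<A>\<close> in this sense, and let
  \<open>u\<^sub>\<omega>(\<A>)\<close> be the upward closure of \<open>\<A>\<close> under Turing reducibility.  A universal machine
  gives \<open>\<A> \<le>\<^sub>n u\<^sub>n(\<A>)\<close>, and prefixing \<open>r\<close> (for \<open>n = \<omega>\<close>: the identity) shows that \<open>\<A> \<le>\<^sub>n \<X>\<close>
  already implies \<open>u\<^sub>n(\<A>) \<le>\<^sub>0 \<X>\<close>.
  Hence \<open>u\<^sub>n(\<A>) \<le>\<^sub>m \<X>\<close> is equivalent to \<open>\<A> \<le>\<^sub>n \<X>\<close> for every \<open>m \<le> n\<close>, and order, joins and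
  implications are determined by such equivalences.
\<close>

abbreviation pr :: "nat \<Rightarrow> nat \<Rightarrow> nat" where "pr a b \<equiv> prod_encode (a, b)"
abbreviation p1 :: "nat \<Rightarrow> nat" where "p1 z \<equiv> fst (prod_decode z)"
abbreviation p2 :: "nat \<Rightarrow> nat" where "p2 z \<equiv> snd (prod_decode z)"

section \<open>Total computable functionals\<close>

text \<open>One program serves all oracles and converges everywhere, so closure properties involve
  no divergence; computability without an oracle is the case of a functional constant in
  \<open>f\<close>.\<close>

definition recursive :: "((nat \<Rightarrow> nat) \<Rightarrow> nat \<Rightarrow> nat) \<Rightarrow> bool" where
  "recursive F \<longleftrightarrow> (\<exists>c. \<forall>f x. eval c f x = Some (F f x))"

definition decidable :: "((nat \<Rightarrow> nat) \<Rightarrow> nat \<Rightarrow> bool) \<Rightarrow> bool" where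
  "decidable P \<longleftrightarrow> recursive (\<lambda>f x. of_bool (P f x))"

lemma recursiveI: "(\<And>f x. eval c f x = Some (F f x)) \<Longrightarrow> recursive F"
  unfolding recursive_def by blast

lemma recursiveE: assumes "recursive F" obtains c where "\<And>f x. eval c f x = Some (F f x)"
  using assms unfolding recursive_def by blast

lemma recursive_comp:
  assumes "recursive G" "recursive a" shows "recursive (\<lambda>f x. G f (a f x))"
proof -
  obtain c d where "\<And>f x. eval c f x = Some (G f x)" "\<And>f x. eval d f x = Some (a f x)"
    using assms by (metis recursiveE)
  then show ?thesis by (intro recursiveI[of "Comp c d"]) simp
qed

lemma recursive_id: "recursive (\<lambda>f x. x)"
  by (rule recursiveI[of "Pair Left Right"]) simp

lemma recursive_const: "recursive (\<lambda>f x. k)"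
proof (induction k)
  case 0 show ?case by (rule recursiveI[of Zero]) simp
next
  case (Suc k)
  then obtain c where "\<And>f x. eval c f x = Some k" by (metis recursiveE)
  then show ?case by (intro recursiveI[of "Comp Succ c"]) simp
qed

lemma recursive_basic: "recursive (\<lambda>f. Suc)" "recursive (\<lambda>f. p1)" "recursive (\<lambda>f. p2)" "recursive (\<lambda>f. f)"
  by (rule recursiveI[of Succ] recursiveI[of Left] recursiveI[of Right] recursiveI[of Oracle], simp)+

lemmas recursive_Suc = recursive_comp[OF recursive_basic(1)]
lemmas recursive_p1 = recursive_comp[OF recursive_basic(2)]
lemmas recursive_p2 = recursive_comp[OF recursive_basic(3)]
lemmas recursive_oracle = recursive_comp[OF recursive_basic(4)]

lemma recursive_pr:
  assumes "recursive a" "recursive b" shows "recursive (\<lambda>f x. pr (a f x) (b f x))"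
proof -
  obtain c d where "\<And>f x. eval c f x = Some (a f x)" "\<And>f x. eval d f x = Some (b f x)"
    using assms by (metis recursiveE)
  then show ?thesis by (intro recursiveI[of "Pair c d"]) simp
qed

text \<open>The whole input \<open>x\<close> becomes the parameter of \<open>Prec\<close>, so base
  and step may both depend on it; all values being defined, the recursion through
  \<open>Option.bind\<close> never fails.\<close>

lemma recursive_rec:
  assumes "recursive a" "recursive n" "recursive (\<lambda>f z. B f (p1 z) (p1 (p2 z)) (p2 (p2 z)))"
  shows "recursive (\<lambda>f x. rec_nat (a f x) (\<lambda>k r. B f x k r) (n f x))"
proof -
  obtain c e d where
    c: "\<And>f x. eval c f x = Some (a f x)" and
    e: "\<And>f x. eval e f x = Some (n f x)" and
    d: "\<And>f z. eval d f z = Some (B f (p1 z) (p1 (p2 z)) (p2 (p2 z)))"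
    using assms by (metis (no_types, lifting) recursiveE)
  have "rec_nat (Some (a f x)) (\<lambda>k v. Option.bind v (\<lambda>r. eval d f (pr x (pr k r)))) m
      = Some (rec_nat (a f x) (\<lambda>k r. B f x k r) m)" for f x m
    by (induction m) (auto simp: d)
  then show ?thesis
    by (intro recursiveI[of "Comp (Prec c d) (Pair (Pair Left Right) e)"]) (simp add: c e)
qed

lemma recursive_if0:
  assumes "recursive c" "recursive a" "recursive b"
  shows "recursive (\<lambda>f x. if c f x = 0 then a f x else b f x)"
proof -
  have "recursive (\<lambda>f x. rec_nat (a f x) (\<lambda>k r. b f x) (c f x))"
    by (intro recursive_rec recursive_comp[OF assms(3)] assms recursive_p1 recursive_id)
  moreover have "rec_nat (a f x) (\<lambda>k r. b f x) (c f x) = (if c f x = 0 then a f x else b f x)" for f x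
    by (cases "c f x") auto
  ultimately show ?thesis by simp
qed

lemma recursive_pred:
  assumes "recursive a" shows "recursive (\<lambda>f x. a f x - 1)"
proof -
  have "recursive (\<lambda>f x. rec_nat 0 (\<lambda>k r. k) (a f x))"
    by (intro recursive_rec recursive_const assms recursive_p1 recursive_p2 recursive_id)
  moreover have "rec_nat 0 (\<lambda>k r. k) m = m - 1" for m :: nat by (cases m) auto
  ultimately show ?thesis by simp
qed

lemma recursive_add:
  assumes "recursive a" "recursive b" shows "recursive (\<lambda>f x. a f x + b f x)"
proof -
  have "recursive (\<lambda>f x. rec_nat (a f x) (\<lambda>k r. Suc r) (b f x))"
    by (intro recursive_rec recursive_Suc assms recursive_p2 recursive_id)
  moreover have "rec_nat m (\<lambda>k r. Suc r) n = m + n" for m n by (induction n) auto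
  ultimately show ?thesis by simp
qed

lemma recursive_diff:
  assumes "recursive a" "recursive b" shows "recursive (\<lambda>f x. a f x - b f x)"
proof -
  have "recursive (\<lambda>f x. rec_nat (a f x) (\<lambda>k r. r - 1) (b f x))"
    by (intro recursive_rec recursive_pred assms recursive_p2 recursive_id)
  moreover have "rec_nat m (\<lambda>k r. r - 1) n = m - n" for m n :: nat by (induction n) auto
  ultimately show ?thesis by simp
qed

lemma recursive_mult:
  assumes "recursive a" "recursive b" shows "recursive (\<lambda>f x. a f x * b f x)"
proof -
  have "recursive (\<lambda>f x. rec_nat 0 (\<lambda>k r. a f x + r) (b f x))"
    by (intro recursive_rec recursive_add recursive_comp[OF assms(1)] recursive_const assms
        recursive_p1 recursive_p2 recursive_id)
  moreover have "rec_nat 0 (\<lambda>k r. m + r) n = m * n" for m n :: nat by (induction n) auto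
  ultimately show ?thesis by simp
qed

lemma decidable_eq:
  assumes "recursive a" "recursive b" shows "decidable (\<lambda>f x. a f x = b f x)"
proof -
  have "recursive (\<lambda>f x. if (a f x - b f x) + (b f x - a f x) = 0 then 1 else 0)"
    by (intro recursive_if0 recursive_add recursive_diff assms recursive_const)
  moreover have "(if (m - n) + (n - m) = 0 then 1 else 0) = (of_bool (m = n) :: nat)" for m n :: nat by auto
  ultimately show ?thesis unfolding decidable_def by simp
qed

lemma decidable_not:
  assumes "decidable P" shows "decidable (\<lambda>f x. \<not> P f x)"
proof -
  have "recursive (\<lambda>f x. 1 - of_bool (P f x))"
    by (intro recursive_diff recursive_const assms[unfolded decidable_def])
  moreover have "1 - of_bool p = (of_bool (\<not> p) :: nat)" for p by simp
  ultimately show ?thesis unfolding decidable_def by simp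
qed

lemma decidable_conj:
  assumes "decidable P" "decidable Q" shows "decidable (\<lambda>f x. P f x \<and> Q f x)"
  using recursive_mult[OF assms[unfolded decidable_def]] unfolding decidable_def by (simp add: of_bool_conj)

lemma decidable_disj:
  assumes "decidable P" "decidable Q" shows "decidable (\<lambda>f x. P f x \<or> Q f x)"
  using decidable_not[OF decidable_conj[OF assms[THEN decidable_not]]] by simp

lemma recursive_if:
  assumes "decidable P" "recursive a" "recursive b"
  shows "recursive (\<lambda>f x. if P f x then a f x else b f x)"
proof -
  have "recursive (\<lambda>f x. if of_bool (P f x) = (0::nat) then b f x else a f x)"
    by (intro recursive_if0 assms assms[unfolded decidable_def])
  moreover have "(if of_bool p = (0::nat) then y else x) = (if p then x else y)" for p and x y :: nat by simp
  ultimately show ?thesis by simp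
qed

lemma decidable_comp: "decidable P \<Longrightarrow> recursive a \<Longrightarrow> decidable (\<lambda>f x. P f (a f x))"
  unfolding decidable_def by (rule recursive_comp)

lemmas recursive_intros =
  recursive_id recursive_const recursive_Suc recursive_p1 recursive_p2 recursive_oracle recursive_pr
  recursive_add recursive_diff recursive_mult decidable_eq decidable_not decidable_conj decidable_disj
  recursive_if recursive_rec

lemma recursive_mod:
  assumes "recursive a" "k > 0" shows "recursive (\<lambda>f x. a f x mod k)"
proof -
  have "recursive (\<lambda>f x. rec_nat 0 (\<lambda>i r. if Suc r = k then 0 else Suc r) (a f x))"
    by (intro recursive_intros assms)
  moreover have "rec_nat 0 (\<lambda>i r. if Suc r = k then 0 else Suc r) m = m mod k" for m
    by (induction m) (auto simp: mod_Suc assms(2))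
  ultimately show ?thesis by simp
qed

lemma recursive_div:
  assumes "recursive a" "k > 0" shows "recursive (\<lambda>f x. a f x div k)"
proof -
  have "recursive (\<lambda>f x. rec_nat 0 (\<lambda>i r. if Suc i mod k = 0 then Suc r else r) (a f x))"
    by (intro recursive_intros recursive_mod assms)
  moreover have "rec_nat 0 (\<lambda>i r. if Suc i mod k = 0 then Suc r else r) m = m div k" for m
    by (induction m) (auto simp: div_Suc assms(2))
  ultimately show ?thesis by simp
qed

lemma recursive_funpow:
  assumes "recursive a" "recursive n" "recursive (\<lambda>f z. G f (p1 z) (p2 z))"
  shows "recursive (\<lambda>f x. (G f x ^^ n f x) (a f x))"
proof -
  have "recursive (\<lambda>f x. rec_nat (a f x) (\<lambda>k r. G f x r) (n f x))"
    using recursive_comp[OF assms(3), of "\<lambda>f z. pr (p1 z) (p2 (p2 z))"]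
    by (intro recursive_rec assms) (simp add: recursive_intros)
  moreover have "rec_nat y (\<lambda>k r. g r) m = (g ^^ m) y" for y m and g :: "nat \<Rightarrow> nat" by (induction m) auto
  ultimately show ?thesis by simp
qed

section \<open>Substitution and indices\<close>

text \<open>Replaces oracle calls by \<open>d\<close>; a parameter in the first component of the input is passed on to all of them.\<close>

fun psub :: "code \<Rightarrow> code \<Rightarrow> code" where
  "psub d Zero = Zero"
| "psub d Succ = Comp Succ Right"
| "psub d Left = Comp Left Right"
| "psub d Right = Comp Right Right"
| "psub d Oracle = d"
| "psub d (Pair p q) = Pair (psub d p) (psub d q)"
| "psub d (Comp p q) = Comp (psub d p) (Pair Left (psub d q))"
| "psub d (Prec p q) =
    Comp (Prec (psub d p) (Comp (psub d q) (Pair (Comp Left Left) (Pair (Comp Right Left) Right))))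
      (Pair (Pair Left (Comp Left Right)) (Comp Right Right))"
| "psub d (Mu p) = Mu (Comp (psub d p) (Pair (Comp Left Left) (Pair (Comp Right Left) Right)))"

text \<open>Every clause of \<open>psub\<close> restores the parameter before calling a subprogram,
  so each oracle call reaches \<open>d\<close> with the same \<open>j\<close>. Convergence of
  \<open>d\<close> is assumed for this \<open>j\<close> only, which suits functionals that are total
  only on the right piece of a cover.\<close>

lemma eval_psub:
  assumes "\<And>q. eval d f (pr j q) = Some (g q)"
  shows "eval (psub d c) f (pr j x) = eval c g x"
proof (induction c arbitrary: x)
  case (Comp c1 c2)
  then show ?case by (cases "eval c2 g x") auto
qed (simp_all add: assms)

section \<open>Numbering of programs and the s-m-n theorem\<close>

fun enc :: "code \<Rightarrow> nat" where
  "enc Zero = 0"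
| "enc Succ = 1"
| "enc Left = 2"
| "enc Right = 3"
| "enc Oracle = 4"
| "enc (Pair p q) = 5 + 4 * pr (enc p) (enc q)"
| "enc (Comp p q) = 5 + (4 * pr (enc p) (enc q) + 1)"
| "enc (Prec p q) = 5 + (4 * pr (enc p) (enc q) + 2)"
| "enc (Mu p) = 5 + (4 * enc p + 3)"

text \<open>Kept in the unnormalized form in which \<open>enc\<close> and \<open>smn\<close> build
  indices, so that \<open>code_of\<close> can be evaluated by rewriting.\<close>

lemma index_arith:
  "(5 + 4 * q - 5) div 4 = q" "(5 + 4 * q - 5) mod 4 = 0"
  "(5 + (4 * q + 1) - 5) div 4 = q" "(5 + (4 * q + 1) - 5) mod 4 = 1"
  "(5 + (4 * q + 2) - 5) div 4 = q" "(5 + (4 * q + 2) - 5) mod 4 = 2"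
  "(5 + (4 * q + 3) - 5) div 4 = q" "(5 + (4 * q + 3) - 5) mod 4 = 3" for q :: nat
proof -
  have r: "(5 + (4 * q + r) - 5) div 4 = q" "(5 + (4 * q + r) - 5) mod 4 = r" if "r < 4" for r :: nat
    using that by simp_all
  note r[of 0, simplified add_0_right] r[of 1] r[of 2] r[of 3]
  then show "(5 + 4 * q - 5) div 4 = q" "(5 + 4 * q - 5) mod 4 = 0"
    "(5 + (4 * q + 1) - 5) div 4 = q" "(5 + (4 * q + 1) - 5) mod 4 = 1"
    "(5 + (4 * q + 2) - 5) div 4 = q" "(5 + (4 * q + 2) - 5) mod 4 = 2"
    "(5 + (4 * q + 3) - 5) div 4 = q" "(5 + (4 * q + 3) - 5) mod 4 = 3"
    by simp_all
qed

lemma code_of_enc_eqs: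
  "code_of 0 = Zero" "code_of (Suc 0) = Succ" "code_of 2 = Left" "code_of 3 = Right" "code_of 4 = Oracle"
  "code_of (5 + 4 * q) = Pair (code_of (p1 q)) (code_of (p2 q))"
  "code_of (5 + (4 * q + 1)) = Comp (code_of (p1 q)) (code_of (p2 q))"
  "code_of (5 + (4 * q + 2)) = Prec (code_of (p1 q)) (code_of (p2 q))"
  "code_of (5 + (4 * q + 3)) = Mu (code_of q)"
proof -
  show "code_of 0 = Zero" "code_of (Suc 0) = Succ" "code_of 2 = Left" "code_of 3 = Right" "code_of 4 = Oracle"
    by (subst code_of.simps, simp)+
  show "code_of (5 + 4 * q) = Pair (code_of (p1 q)) (code_of (p2 q))"
    by (subst code_of.simps) (simp only: index_arith, simp)
  show "code_of (5 + (4 * q + 1)) = Comp (code_of (p1 q)) (code_of (p2 q))"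
    by (subst code_of.simps) (simp only: index_arith, simp)
  show "code_of (5 + (4 * q + 2)) = Prec (code_of (p1 q)) (code_of (p2 q))"
    by (subst code_of.simps) (simp only: index_arith, simp)
  show "code_of (5 + (4 * q + 3)) = Mu (code_of q)"
    by (subst code_of.simps) (simp only: index_arith, simp)
qed

lemma code_of_enc: "code_of (enc c) = c"
  by (induction c) (simp_all only: enc.simps One_nat_def code_of_enc_eqs[unfolded One_nat_def]
      prod_encode_inverse fst_conv snd_conv)

text \<open>An index of \<open>Zero\<close> followed by \<open>a\<close> applications of
  \<open>Succ\<close>: the step forms the index of \<open>Comp\<close> with outer program
  \<open>Succ\<close>. As a recursion on numbers it is visibly computable in
  \<open>a\<close>.\<close>

definition const_index :: "nat \<Rightarrow> nat" where
  "const_index a = rec_nat 0 (\<lambda>k r. 5 + (4 * pr 1 r + 1)) a"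

lemma eval_const_index: "eval (code_of (const_index a)) f x = Some a"
proof (induction a)
  case 0
  then show ?case by (simp add: const_index_def code_of_enc_eqs)
next
  case (Suc a)
  have "const_index (Suc a) = 5 + (4 * pr 1 (const_index a) + 1)" by (simp add: const_index_def)
  then show ?case using Suc by (simp only: code_of_enc_eqs) (simp add: code_of_enc_eqs)
qed

text \<open>The index of program \<open>e\<close> composed with \<open>x \<mapsto> pr a x\<close>;
  \<open>Pair Left Right\<close> is the identity.\<close>

definition smn :: "nat \<Rightarrow> nat \<Rightarrow> nat" where
  "smn e a = 5 + (4 * pr e (5 + 4 * pr (const_index a) (enc (Pair Left Right))) + 1)"

lemma eval_smn: "eval (code_of (smn e a)) f x = eval (code_of e) f (pr a x)"
  unfolding smn_def code_of_enc_eqs prod_encode_inverse fst_conv snd_conv eval.simps eval_const_index code_of_enc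
  by simp

lemma recursive_smn:
  assumes "recursive a" shows "recursive (\<lambda>f x. smn e (a f x))"
  unfolding smn_def const_index_def by (intro recursive_intros assms)

text \<open>Substituting \<open>Zero\<close> for the oracle turns a computation over the zero oracle
  into one that runs alike over every oracle; the converse is an instance.\<close>

lemma computable_iff_recursive: "computable g \<longleftrightarrow> recursive (\<lambda>f. g)"
proof
  assume "computable g"
  then obtain e where e: "\<And>x. eval (code_of e) (\<lambda>_. 0) x = Some (g x)"
    unfolding computable_def phi_def Phi_def by blast
  then have "eval (Comp (psub Zero (code_of e)) (Pair Zero (Pair Left Right))) f x = Some (g x)" for f x
    using eval_psub[of Zero f 0 "\<lambda>_. 0" "code_of e" x] by simp
  then show "recursive (\<lambda>f. g)" by (rule recursiveI)
next
  assume "recursive (\<lambda>f. g)"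
  then obtain c where "\<And>f x. eval c f x = Some (g x)" by (rule recursiveE) blast
  then show "computable g" unfolding computable_def phi_def Phi_def by (metis code_of_enc)
qed

section \<open>A universal machine\<close>

text \<open>
  A stack machine on numbers.  The oracle may be partial: the answer \<open>0\<close> means undefined, in which
  case the machine is stuck, and the answer \<open>Suc v\<close> means \<open>v\<close>.  In the state \<open>Ev e x K\<close> program \<open>e\<close> is
  to be run on \<open>x\<close>; in the state \<open>Rt v K\<close> the value \<open>v\<close> is returned to the topmost frame of the stack \<open>K\<close>.
  \<open>Fr t d K\<close> pushes a frame of kind \<open>t\<close> with data \<open>d\<close>; the empty stack is \<open>0\<close>.
\<close>

definition Ev :: "nat \<Rightarrow> nat \<Rightarrow> nat \<Rightarrow> nat" where "Ev e x K = pr 0 (pr e (pr x K))"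
definition Rt :: "nat \<Rightarrow> nat \<Rightarrow> nat" where "Rt v K = pr 1 (pr v K)"
definition Fr :: "nat \<Rightarrow> nat \<Rightarrow> nat \<Rightarrow> nat" where "Fr t d K = Suc (pr t (pr d K))"

definition step_eval :: "(nat \<Rightarrow> nat) \<Rightarrow> nat \<Rightarrow> nat \<Rightarrow> nat \<Rightarrow> nat" where
  "step_eval ora e x K =
    (if e = 0 then Rt 0 K
     else if e = 1 then Rt (Suc x) K
     else if e = 2 then Rt (p1 x) K
     else if e = 3 then Rt (p2 x) K
     else if e = 4 then (if ora x = 0 then Ev e x K else Rt (ora x - 1) K)
     else if (e - 5) mod 4 = 0 then
       Ev (p1 ((e - 5) div 4)) x (Fr 0 (pr (p2 ((e - 5) div 4)) x) K)
     else if (e - 5) mod 4 = 1 then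
       Ev (p2 ((e - 5) div 4)) x (Fr 1 (p1 ((e - 5) div 4)) K)
     else if (e - 5) mod 4 = 2 then
       Ev (p1 ((e - 5) div 4)) (p1 x) (Fr 2 (pr (p2 ((e - 5) div 4)) (pr (p1 x) (pr 0 (p2 x)))) K)
     else Ev ((e - 5) div 4) (pr x 0) (Fr 3 (pr ((e - 5) div 4) (pr x 0)) K))"

text \<open>Data by kind of frame: 0, the second program of a \<open>Pair\<close> and its input; 1,
  the outer program of a \<open>Comp\<close>; 2, step program, parameter, counter and bound of a
  recursion; 3, program, input and current candidate of a search; 4, the first component of a pair,
  already computed.\<close>

definition step_frame :: "nat \<Rightarrow> nat \<Rightarrow> nat \<Rightarrow> nat \<Rightarrow> nat" where
  "step_frame v t d K =
    (if t = 0 then Ev (p1 d) (p2 d) (Fr 4 v K)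
     else if t = 1 then Ev d v K
     else if t = 2 then
       (if p1 (p2 (p2 d)) = p2 (p2 (p2 d)) then Rt v K
        else Ev (p1 d) (pr (p1 (p2 d)) (pr (p1 (p2 (p2 d))) v))
          (Fr 2 (pr (p1 d) (pr (p1 (p2 d)) (pr (Suc (p1 (p2 (p2 d)))) (p2 (p2 (p2 d)))))) K))
     else if t = 3 then
       (if v = 0 then Rt (p2 (p2 d)) K
        else Ev (p1 d) (pr (p1 (p2 d)) (Suc (p2 (p2 d))))
          (Fr 3 (pr (p1 d) (pr (p1 (p2 d)) (Suc (p2 (p2 d))))) K))
     else Rt (pr d v) K)"

text \<open>A value returned to the empty stack is a fixed point, so halting with \<open>v\<close>
  means reaching \<open>Rt v 0\<close>.\<close>

definition step :: "(nat \<Rightarrow> nat) \<Rightarrow> nat \<Rightarrow> nat" where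
  "step ora z =
    (if p1 z = 0 then step_eval ora (p1 (p2 z)) (p1 (p2 (p2 z))) (p2 (p2 (p2 z)))
     else if p2 (p2 z) = 0 then z
     else step_frame (p1 (p2 z)) (p1 (p2 (p2 z) - 1)) (p1 (p2 (p2 (p2 z) - 1))) (p2 (p2 (p2 (p2 z) - 1))))"

text \<open>The oracle is a family with a numerical parameter \<open>u\<close>, which covers both
  the full oracle \<open>f\<close> and finite strings given by their codes.\<close>

lemma recursive_step:
  assumes "recursive (\<lambda>f z. ora f (p1 z) (p2 z))" "recursive u" "recursive a"
  shows "recursive (\<lambda>f x. step (ora f (u f x)) (a f x))"
proof -
  have ora: "recursive (\<lambda>f z. ora f (b f z) (c f z))" if "recursive b" "recursive c" for b c
    using recursive_comp[OF assms(1) recursive_pr[OF that]] by simp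
  have "recursive (\<lambda>f z. step (ora f (p1 z)) (p2 z))"
    unfolding step_def step_eval_def step_frame_def Ev_def Rt_def Fr_def
    by (intro recursive_intros recursive_mod recursive_div ora zero_less_numeral)
  from recursive_comp[OF this recursive_pr[OF assms(2,3)]] show ?thesis by simp
qed

lemma step_Rt [simp]: "step ora (Rt v 0) = Rt v 0" "step ora (Rt v (Fr t d K)) = step_frame v t d K"
  by (simp_all add: step_def Rt_def Fr_def)

lemma step_Ev [simp]: "step ora (Ev e x K) = step_eval ora e x K"
  by (simp add: step_def Ev_def)

lemma Rt_inject [simp]: "Rt v K = Rt v' K' \<longleftrightarrow> v = v' \<and> K = K'"
  by (simp add: Rt_def)

lemma Ev_neq_Rt [simp]: "Ev e x K \<noteq> Rt v K'"
  by (simp add: Rt_def Ev_def)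

lemma Fr_neq_0 [simp]: "Fr t d K \<noteq> 0"
  by (simp add: Fr_def)

lemma step_frame_simps [simp]:
  "step_frame v 0 (pr b x) K = Ev b x (Fr 4 v K)"
  "step_frame v (Suc 0) d K = Ev d v K"
  "step_frame v 2 (pr b (pr a (pr k m))) K =
    (if k = m then Rt v K else Ev b (pr a (pr k v)) (Fr 2 (pr b (pr a (pr (Suc k) m))) K))"
  "step_frame v 3 (pr q (pr x k)) K =
    (if v = 0 then Rt k K else Ev q (pr x (Suc k)) (Fr 3 (pr q (pr x (Suc k))) K))"
  "step_frame v 4 d K = Rt (pr d v) K"
  by (simp_all add: step_frame_def)

lemma step_eval_simps:
  "step_eval ora 0 x K = Rt 0 K"
  "step_eval ora (Suc 0) x K = Rt (Suc x) K"
  "step_eval ora 2 x K = Rt (p1 x) K"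
  "step_eval ora 3 x K = Rt (p2 x) K"
  "step_eval ora 4 x K = (if ora x = 0 then Ev 4 x K else Rt (ora x - 1) K)"
  "step_eval ora (5 + 4 * q) x K = Ev (p1 q) x (Fr 0 (pr (p2 q) x) K)"
  "step_eval ora (5 + (4 * q + 1)) x K = Ev (p2 q) x (Fr 1 (p1 q) K)"
  "step_eval ora (5 + (4 * q + 2)) x K = Ev (p1 q) (p1 x) (Fr 2 (pr (p2 q) (pr (p1 x) (pr 0 (p2 x)))) K)"
  "step_eval ora (5 + (4 * q + 3)) x K = Ev q (pr x 0) (Fr 3 (pr q (pr x 0)) K)"
  unfolding step_eval_def index_arith by simp_all

lemma index_cases:
  fixes e :: nat
  obtains "e = 0" | "e = Suc 0" | "e = 2" | "e = 3" | "e = 4"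
    | q where "e = 5 + 4 * q" | q where "e = 5 + (4 * q + 1)"
    | q where "e = 5 + (4 * q + 2)" | q where "e = 5 + (4 * q + 3)"
proof (cases "e < 5")
  case True
  then consider "e = 0" | "e = Suc 0" | "e = 2" | "e = 3" | "e = 4" by linarith
  then show ?thesis using that by cases blast+
next
  case False
  define q where "q = (e - 5) div 4"
  have "e = 5 + (4 * q + (e - 5) mod 4)" using False by (simp add: q_def)
  moreover have "(e - 5) mod 4 < 4" by simp
  ultimately consider "e = 5 + 4 * q" | "e = 5 + (4 * q + 1)" | "e = 5 + (4 * q + 2)" | "e = 5 + (4 * q + 3)"
    by linarith
  then show ?thesis using that by cases blast+
qed

lemma eval_Mu_eqI:
  assumes "eval p f (pr x k) = Some 0" "\<And>j. j < k \<Longrightarrow> \<exists>y. eval p f (pr x j) = Some (Suc y)"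
  shows "eval (Mu p) f x = Some k"
proof -
  have "(LEAST k. eval p f (pr x k) = Some 0) = k"
    by (rule Least_equality) (use assms in \<open>force simp: not_less[symmetric]\<close>)+
  moreover have "\<exists>k. eval p f (pr x k) = Some 0 \<and> (\<forall>j<k. eval p f (pr x j) \<noteq> None)"
    using assms by (intro exI[of _ k]) force
  ultimately show ?thesis by simp
qed

lemma eval_Mu_eqD:
  assumes "eval (Mu p) f x = Some k"
  shows "eval p f (pr x k) = Some 0" "\<And>j. j < k \<Longrightarrow> \<exists>y. eval p f (pr x j) = Some (Suc y)"
proof -
  let ?P = "\<lambda>k. eval p f (pr x k) = Some 0"
  obtain k' where k': "?P k'" "\<And>j. j < k' \<Longrightarrow> eval p f (pr x j) \<noteq> None"
    using assms by (auto split: if_splits)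
  have k: "k = (LEAST k. ?P k)" using assms by (auto split: if_splits)
  show "?P k" unfolding k by (rule LeastI) (rule k')
  fix j assume "j < k"
  moreover have "k \<le> k'" unfolding k by (rule Least_le) (rule k')
  ultimately have "\<not> ?P j" "eval p f (pr x j) \<noteq> None"
    using k not_less_Least k'(2) by auto
  then show "\<exists>y. eval p f (pr x j) = Some (Suc y)"
    by (metis not0_implies_Suc option.exhaust)
qed

definition reach :: "(nat \<Rightarrow> nat) \<Rightarrow> nat \<Rightarrow> nat \<Rightarrow> bool" where
  "reach ora a b \<longleftrightarrow> (\<exists>n. (step ora ^^ n) a = b)"

lemma reach_trans [trans]: "reach ora a b \<Longrightarrow> reach ora b c \<Longrightarrow> reach ora a c"
  unfolding reach_def by (metis comp_apply funpow_add)

lemma reach_step: "reach ora (step ora a) b \<Longrightarrow> reach ora a b"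
  unfolding reach_def by (metis comp_apply funpow_Suc_right)

lemma reach_refl: "reach ora a a"
  unfolding reach_def by (metis funpow_0)

text \<open>Induction on the index, for all stacks \<open>K\<close> at once, because subprograms run
  on top of a pushed frame.\<close>

lemma machine_complete:
  assumes "eval (code_of e) f x = Some v"
  shows "reach (\<lambda>q. Suc (f q)) (Ev e x K) (Rt v K)"
  using assms
proof (induction e arbitrary: x v K rule: less_induct)
  case (less e)
  let ?R = "reach (\<lambda>q. Suc (f q))"
  note [simp] = code_of_enc_eqs step_eval_simps
  have lt: "p1 q \<le> q" "p2 q \<le> q" for q by (rule fst_prod_decode_le snd_prod_decode_le)+
  show ?case
  proof (cases e rule: index_cases)
    case (6 q)
    have lt': "p1 q < e" "p2 q < e" using lt[of q] 6 by linarith+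
    obtain a b where ab: "eval (code_of (p1 q)) f x = Some a" "eval (code_of (p2 q)) f x = Some b" "v = pr a b"
      using less.prems unfolding 6 code_of_enc_eqs by (auto simp: bind_eq_Some_conv)
    have "?R (Ev (p2 q) x (Fr 4 a K)) (Rt v K)"
      by (rule reach_trans[OF less.IH[OF lt'(2) ab(2)]], rule reach_step) (simp add: ab reach_refl)
    then have "?R (Rt a (Fr 0 (pr (p2 q) x) K)) (Rt v K)" by - (rule reach_step, simp)
    with less.IH[OF lt'(1) ab(1)] have "?R (Ev (p1 q) x (Fr 0 (pr (p2 q) x) K)) (Rt v K)"
      by (rule reach_trans)
    then show ?thesis unfolding 6 by - (rule reach_step, simp only: step_Ev step_eval_simps)
  next
    case (7 q)
    have lt': "p1 q < e" "p2 q < e" using lt[of q] 7 by linarith+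
    obtain a where ab: "eval (code_of (p2 q)) f x = Some a" "eval (code_of (p1 q)) f a = Some v"
      using less.prems unfolding 7 code_of_enc_eqs by (auto simp: bind_eq_Some_conv)
    have "?R (Rt a (Fr 1 (p1 q) K)) (Rt v K)"
      by (rule reach_step) (simp add: less.IH[OF lt'(1) ab(2)])
    with less.IH[OF lt'(2) ab(1)] have "?R (Ev (p2 q) x (Fr 1 (p1 q) K)) (Rt v K)"
      by (rule reach_trans)
    then show ?thesis unfolding 7 by - (rule reach_step, simp only: step_Ev step_eval_simps)
  next
    case (8 q)
    have lt': "p1 q < e" "p2 q < e" using lt[of q] 8 by linarith+
    define V where "V = rec_nat (eval (code_of (p1 q)) f (p1 x))
       (\<lambda>k v. Option.bind v (\<lambda>r. eval (code_of (p2 q)) f (pr (p1 x) (pr k r))))"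
    let ?F = "\<lambda>k. Fr 2 (pr (p2 q) (pr (p1 x) (pr k (p2 x)))) K"
    have V: "V (p2 x) = Some v" using less.prems unfolding 8 code_of_enc_eqs by (simp add: V_def)
    \<comment> \<open>Loop invariant: the value at \<open>k\<close> is returned to the frame whose
      counter is \<open>k\<close>.\<close>
    have *: "?R (Ev (p1 q) (p1 x) (?F 0)) (Rt r (?F k))" if "V k = Some r" "k \<le> p2 x" for k r
      using that
    proof (induction k arbitrary: r)
      case 0
      then show ?case using less.IH[OF lt'(1)] by (simp add: V_def)
    next
      case (Suc k)
      then obtain r' where r': "V k = Some r'" "eval (code_of (p2 q)) f (pr (p1 x) (pr k r')) = Some r"
        by (auto simp: V_def bind_eq_Some_conv)
      have "?R (Ev (p1 q) (p1 x) (?F 0)) (Rt r' (?F k))"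
        using Suc.IH[OF r'(1)] Suc.prems by simp
      moreover have "?R (Rt r' (?F k)) (Rt r (?F (Suc k)))"
        using Suc.prems by - (rule reach_step, simp add: less.IH[OF lt'(2) r'(2)])
      ultimately show ?case by - (rule reach_trans)
    qed
    have "?R (Rt v (?F (p2 x))) (Rt v K)" by (rule reach_step) (simp add: reach_refl)
    with *[OF V order_refl] have "?R (Ev (p1 q) (p1 x) (?F 0)) (Rt v K)" by (rule reach_trans)
    then show ?thesis unfolding 8 by - (rule reach_step, simp only: step_Ev step_eval_simps(8))
  next
    case (9 q)
    have lt': "q < e" using 9 by linarith
    have ev: "eval (Mu (code_of q)) f x = Some v"
      using less.prems unfolding 9 code_of_enc_eqs .
    note ev = eval_Mu_eqD[OF ev]
    let ?F = "\<lambda>k. Fr 3 (pr q (pr x k)) K"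
    \<comment> \<open>Loop invariant: after nonzero answers on all smaller candidates the machine
      tries \<open>k\<close>.\<close>
    have *: "?R (Ev q (pr x 0) (?F 0)) (Ev q (pr x k) (?F k))" if "k \<le> v" for k
      using that
    proof (induction k)
      case 0
      then show ?case by (simp add: reach_refl)
    next
      case (Suc k)
      then obtain y where y: "eval (code_of q) f (pr x k) = Some (Suc y)" using ev(2)[of k] by auto
      have "?R (Ev q (pr x 0) (?F 0)) (Ev q (pr x k) (?F k))" using Suc by simp
      also have "?R (Ev q (pr x k) (?F k)) (Rt (Suc y) (?F k))" by (rule less.IH[OF lt' y])
      also have "?R (Rt (Suc y) (?F k)) (Ev q (pr x (Suc k)) (?F (Suc k)))"
        by (rule reach_step) (simp add: reach_refl)
      finally show ?case .
    qed
    have "?R (Ev q (pr x v) (?F v)) (Rt v K)"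
      by (rule reach_trans[OF less.IH[OF lt' ev(1)]], rule reach_step) (simp add: reach_refl)
    with *[OF order_refl] have "?R (Ev q (pr x 0) (?F 0)) (Rt v K)" by (rule reach_trans)
    then show ?thesis unfolding 9 by - (rule reach_step, simp only: step_Ev step_eval_simps(9))
  next
    case 1 with less.prems show ?thesis by - (rule reach_step, simp add: reach_refl)
  next
    case 2 with less.prems show ?thesis by - (rule reach_step, simp add: reach_refl)
  next
    case 3 with less.prems show ?thesis by - (rule reach_step, simp add: reach_refl)
  next
    case 4 with less.prems show ?thesis by - (rule reach_step, simp add: reach_refl)
  next
    case 5 with less.prems show ?thesis by - (rule reach_step, simp add: reach_refl)
  qed
qed

lemma funpow_RtD:
  assumes "(step ora ^^ m) (Rt v (Fr t d K)) = Rt w 0"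
  obtains m' where "m = Suc m'" "(step ora ^^ m') (step_frame v t d K) = Rt w 0"
proof (cases m)
  case 0
  then show ?thesis using assms by simp
next
  case (Suc m')
  then show ?thesis using assms that by (simp add: funpow_Suc_right del: funpow.simps)
qed

text \<open>A run ending on the empty stack must first return a value to \<open>K\<close>. Strong
  induction on the length of the run; the strict bound \<open>m < n\<close> makes the hypothesis
  available again for what remains after each subcomputation.\<close>

lemma machine_sound:
  assumes "(step (\<lambda>q. Suc (f q)) ^^ n) (Ev e x K) = Rt w 0"
  shows "\<exists>v m. m < n \<and> eval (code_of e) f x = Some v \<and> (step (\<lambda>q. Suc (f q)) ^^ m) (Rt v K) = Rt w 0"
  using assms
proof (induction n arbitrary: e x K rule: less_induct)
  case (less n)
  let ?S = "step (\<lambda>q. Suc (f q))"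
  obtain n' where n: "n = Suc n'" using less.prems by (cases n) auto
  have st: "(?S ^^ n') (step_eval (\<lambda>q. Suc (f q)) e x K) = Rt w 0"
    using less.prems unfolding n by (simp add: funpow_Suc_right del: funpow.simps)
  have n'n: "n' < n" by (simp add: n)
  show ?case
  proof (cases e rule: index_cases)
    case (6 q)
    obtain a m1 where 1: "m1 < n'" "eval (code_of (p1 q)) f x = Some a"
      "(?S ^^ m1) (Rt a (Fr 0 (pr (p2 q) x) K)) = Rt w 0"
      using less.IH[OF n'n st[unfolded 6 step_eval_simps]] by blast
    obtain m2 where 2: "m1 = Suc m2" "(?S ^^ m2) (Ev (p2 q) x (Fr 4 a K)) = Rt w 0"
      using funpow_RtD[OF 1(3)] by (metis step_frame_simps(1))
    have "m2 < n" using 1 2 n by simp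
    from less.IH[OF this 2(2)] obtain b m3 where 3: "m3 < m2" "eval (code_of (p2 q)) f x = Some b"
      "(?S ^^ m3) (Rt b (Fr 4 a K)) = Rt w 0" by blast
    obtain m4 where 4: "m3 = Suc m4" "(?S ^^ m4) (Rt (pr a b) K) = Rt w 0"
      using funpow_RtD[OF 3(3)] by (metis step_frame_simps(5))
    have "eval (code_of e) f x = Some (pr a b)" unfolding 6 code_of_enc_eqs using 1 3 by simp
    moreover have "m4 < n" using 1 2 3 4 n by simp
    ultimately show ?thesis using 4 by blast
  next
    case (7 q)
    obtain a m1 where 1: "m1 < n'" "eval (code_of (p2 q)) f x = Some a"
      "(?S ^^ m1) (Rt a (Fr 1 (p1 q) K)) = Rt w 0"
      using less.IH[OF n'n st[unfolded 7 step_eval_simps]] by blast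
    obtain m2 where 2: "m1 = Suc m2" "(?S ^^ m2) (Ev (p1 q) a K) = Rt w 0"
      using funpow_RtD[OF 1(3)] by (metis step_frame_simps(2) One_nat_def)
    have "m2 < n" using 1 2 n by simp
    from less.IH[OF this 2(2)] obtain v m3 where 3: "m3 < m2" "eval (code_of (p1 q)) f a = Some v"
      "(?S ^^ m3) (Rt v K) = Rt w 0" by blast
    have "eval (code_of e) f x = Some v" unfolding 7 code_of_enc_eqs using 1 3 by simp
    moreover have "m3 < n" using 1 2 3 n by simp
    ultimately show ?thesis using 3 by blast
  next
    case (8 q)
    define V where "V = rec_nat (eval (code_of (p1 q)) f (p1 x))
       (\<lambda>k v. Option.bind v (\<lambda>r. eval (code_of (p2 q)) f (pr (p1 x) (pr k r))))"
    let ?F = "\<lambda>k. Fr 2 (pr (p2 q) (pr (p1 x) (pr k (p2 x)))) K"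
    have V: "eval (code_of e) f x = V (p2 x)" unfolding 8 code_of_enc_eqs by (simp add: V_def)
    have *: "\<exists>v m'. m' < n \<and> V (p2 x) = Some v \<and> (?S ^^ m') (Rt v K) = Rt w 0"
      if "m < n" "(?S ^^ m) (Rt r (?F k)) = Rt w 0" "V k = Some r" "k \<le> p2 x" for m r k
      using that
    proof (induction "p2 x - k" arbitrary: m r k)
      case 0
      then have "k = p2 x" by simp
      with 0 obtain m1 where "m = Suc m1" "(?S ^^ m1) (Rt r K) = Rt w 0"
        using funpow_RtD[OF 0(3)] by (metis step_frame_simps(3))
      with 0 \<open>k = p2 x\<close> show ?case by (intro exI[of _ r] exI[of _ m1]) simp
    next
      case (Suc d)
      then have k: "k < p2 x" by simp
      obtain m1 where 1: "m = Suc m1" "(?S ^^ m1) (Ev (p2 q) (pr (p1 x) (pr k r)) (?F (Suc k))) = Rt w 0"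
        using funpow_RtD[OF Suc.prems(2)] k by (metis step_frame_simps(3) less_irrefl)
      have "m1 < n" using 1 Suc.prems by simp
      from less.IH[OF this 1(2)] obtain r' m2 where 2: "m2 < m1"
        "eval (code_of (p2 q)) f (pr (p1 x) (pr k r)) = Some r'" "(?S ^^ m2) (Rt r' (?F (Suc k))) = Rt w 0"
        by blast
      show ?case
      proof (rule Suc.hyps(1))
        show "d = p2 x - Suc k" using Suc by simp
        show "m2 < n" using 1 2 Suc.prems by simp
        show "V (Suc k) = Some r'" using 2 Suc.prems by (simp add: V_def)
        show "Suc k \<le> p2 x" using k by simp
      qed (rule 2)
    qed
    obtain a m1 where 1: "m1 < n'" "eval (code_of (p1 q)) f (p1 x) = Some a" "(?S ^^ m1) (Rt a (?F 0)) = Rt w 0"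
      using less.IH[OF n'n st[unfolded 8 step_eval_simps]] by blast
    show ?thesis unfolding V by (rule *[OF _ 1(3)]) (use 1 n in \<open>auto simp: V_def\<close>)
  next
    case (9 q)
    let ?F = "\<lambda>k. Fr 3 (pr q (pr x k)) K"
    have V: "eval (code_of e) f x = eval (Mu (code_of q)) f x" unfolding 9 code_of_enc_eqs ..
    \<comment> \<open>A search has no bound on its candidates known in advance, so the inner
      induction is on the number of remaining steps.\<close>
    have *: "\<exists>v m'. m' < n \<and> eval (Mu (code_of q)) f x = Some v \<and> (?S ^^ m') (Rt v K) = Rt w 0"
      if "m < n" "(?S ^^ m) (Rt r (?F k)) = Rt w 0" "eval (code_of q) f (pr x k) = Some r"
        "\<And>j. j < k \<Longrightarrow> \<exists>y. eval (code_of q) f (pr x j) = Some (Suc y)" for m r k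
      using that
    proof (induction m arbitrary: r k rule: less_induct)
      case IH: (less m)
      show ?case
      proof (cases r)
        case 0
        obtain m1 where 1: "m = Suc m1" "(?S ^^ m1) (Rt k K) = Rt w 0"
          using funpow_RtD[OF IH.prems(2)] 0 by (metis step_frame_simps(4))
        have "eval (Mu (code_of q)) f x = Some k" by (rule eval_Mu_eqI) (use IH.prems 0 in auto)
        then show ?thesis using 1 IH.prems by (metis Suc_lessD)
      next
        case (Suc y)
        obtain m1 where 1: "m = Suc m1" "(?S ^^ m1) (Ev q (pr x (Suc k)) (?F (Suc k))) = Rt w 0"
          using funpow_RtD[OF IH.prems(2)] Suc by (metis step_frame_simps(4) nat.distinct(1))
        have "m1 < n" using 1 IH.prems by simp
        from less.IH[OF this 1(2)] obtain r' m2 where 2: "m2 < m1"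
          "eval (code_of q) f (pr x (Suc k)) = Some r'" "(?S ^^ m2) (Rt r' (?F (Suc k))) = Rt w 0"
          by blast
        show ?thesis
        proof (rule IH.IH[OF _ _ 2(3) 2(2)])
          show "m2 < m" "m2 < n" using 1 2 IH.prems by simp_all
          show "\<exists>y. eval (code_of q) f (pr x j) = Some (Suc y)" if "j < Suc k" for j
            using that IH.prems Suc by (auto simp: less_Suc_eq)
        qed
      qed
    qed
    obtain a m1 where 1: "m1 < n'" "eval (code_of q) f (pr x 0) = Some a" "(?S ^^ m1) (Rt a (?F 0)) = Rt w 0"
      using less.IH[OF n'n st[unfolded 9 step_eval_simps]] by blast
    show ?thesis unfolding V by (rule *[OF _ 1(3)]) (use 1 n in auto)
  qed (use st n'n in \<open>auto simp: step_eval_simps code_of_enc_eqs\<close>)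
qed

lemma eval_iff_machine:
  "eval (code_of e) f x = Some v \<longleftrightarrow> (\<exists>n. (step (\<lambda>q. Suc (f q)) ^^ n) (Ev e x 0) = Rt v 0)"
proof
  assume "eval (code_of e) f x = Some v"
  from machine_complete[OF this, of 0] show "\<exists>n. (step (\<lambda>q. Suc (f q)) ^^ n) (Ev e x 0) = Rt v 0"
    unfolding reach_def .
next
  have stay: "(step (\<lambda>q. Suc (f q)) ^^ m) (Rt u 0) = Rt u 0" for m u by (induction m) auto
  assume "\<exists>n. (step (\<lambda>q. Suc (f q)) ^^ n) (Ev e x 0) = Rt v 0"
  then show "eval (code_of e) f x = Some v" using machine_sound[of _ f e x 0 v] stay by force
qed

lemma decidable_halts:
  assumes "recursive (\<lambda>f z. ora f (p1 z) (p2 z))" "recursive u" "recursive s" "recursive e" "recursive x" "recursive v"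
  shows "decidable (\<lambda>f z. (step (ora f (u f z)) ^^ s f z) (Ev (e f z) (x f z) 0) = Rt (v f z) 0)"
  unfolding Ev_def Rt_def
  by (intro decidable_eq recursive_funpow recursive_step recursive_comp[OF assms(2)] recursive_intros assms)

lemma ex_pr: "(\<exists>z. P z) \<longleftrightarrow> (\<exists>a b. P (pr a b))"
  by (metis prod.collapse prod_decode_inverse)

text \<open>Unbounded search through the characteristic function of the complement, which vanishes
  at witnesses. The equivalence also says that \<open>c\<close> diverges when there is no
  witness.\<close>

lemma decidable_search:
  assumes "decidable D"
  obtains c where "\<And>f x k. eval c f x = Some k \<longleftrightarrow> D f (pr x k) \<and> (\<forall>j<k. \<not> D f (pr x j))"
proof -
  from decidable_not[OF assms] obtain d where d: "\<And>f x. eval d f x = Some (of_bool (\<not> D f x))"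
    unfolding decidable_def by (rule recursiveE) blast
  have "eval (Mu d) f x = Some k \<longleftrightarrow> D f (pr x k) \<and> (\<forall>j<k. \<not> D f (pr x j))" for f x k
  proof
    assume "eval (Mu d) f x = Some k"
    from eval_Mu_eqD[OF this] show "D f (pr x k) \<and> (\<forall>j<k. \<not> D f (pr x j))"
      by (force simp: d)
  next
    assume "D f (pr x k) \<and> (\<forall>j<k. \<not> D f (pr x j))"
    then show "eval (Mu d) f x = Some k" by (intro eval_Mu_eqI) (auto simp: d)
  qed
  then show ?thesis by (rule that)
qed

text \<open>Search for a pair of a number of steps and a value such that the machine has halted with
  that value after these steps, and return the value.\<close>

lemma universal_code:
  obtains U where "\<And>f e x. eval U f (pr e x) = eval (code_of e) f x"
proof -
  let ?D = "\<lambda>f z. (step (\<lambda>q. Suc (f q)) ^^ p1 (p2 z)) (Ev (p1 (p1 z)) (p2 (p1 z)) 0) = Rt (p2 (p2 z)) 0"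
  have "decidable ?D"
    by (rule decidable_halts[where u = "\<lambda>_ _. 0" and ora = "\<lambda>f _ q. Suc (f q)"]) (intro recursive_intros)+
  then obtain c where c: "\<And>f x k. eval c f x = Some k \<longleftrightarrow> ?D f (pr x k) \<and> (\<forall>j<k. \<not> ?D f (pr x j))"
    by (rule decidable_search) blast
  have "eval (Comp Right c) f (pr e x) = eval (code_of e) f x" for f e x
  proof (cases "eval c f (pr e x)")
    case None
    have "eval (code_of e) f x \<noteq> Some v" for v
    proof
      assume "eval (code_of e) f x = Some v"
      then obtain n where "?D f (pr (pr e x) (pr n v))" unfolding eval_iff_machine by auto
      then have "\<exists>k. ?D f (pr (pr e x) k)" by blast
      from exists_least_iff[THEN iffD1, OF this]
      obtain k where "eval c f (pr e x) = Some k" unfolding c by blast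
      with None show False by simp
    qed
    with None show ?thesis by (cases "eval (code_of e) f x") auto
  next
    case (Some k)
    then have "eval (code_of e) f x = Some (p2 k)" unfolding c eval_iff_machine by auto
    with Some show ?thesis by simp
  qed
  then show ?thesis by (rule that)
qed

section \<open>Relations computably enumerable in the oracle\<close>

definition ce :: "((nat \<Rightarrow> nat) \<Rightarrow> nat \<Rightarrow> bool) \<Rightarrow> bool" where
  "ce R \<longleftrightarrow> (\<exists>c. \<forall>f x. R f x \<longleftrightarrow> eval c f x = Some 0)"

lemma ceI: "(\<And>f x. R f x \<longleftrightarrow> eval c f x = Some 0) \<Longrightarrow> ce R"
  unfolding ce_def by blast

lemma ceE: assumes "ce R" obtains c where "\<And>f x. R f x \<longleftrightarrow> eval c f x = Some 0"
  using assms unfolding ce_def by blast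

lemma ce_comp: assumes "ce R" "recursive a" shows "ce (\<lambda>f x. R f (a f x))"
proof -
  obtain c d where "\<And>f x. R f x \<longleftrightarrow> eval c f x = Some 0" "\<And>f x. eval d f x = Some (a f x)"
    using assms by (metis ceE recursiveE)
  then show ?thesis by (intro ceI[of _ "Comp c d"]) simp
qed

lemma ce_ex_decidable:
  assumes "decidable D" shows "ce (\<lambda>f x. \<exists>s. D f (pr x s))"
proof -
  obtain c where c: "\<And>f x k. eval c f x = Some k \<longleftrightarrow> D f (pr x k) \<and> (\<forall>j<k. \<not> D f (pr x j))"
    by (rule decidable_search[OF assms]) blast
  have "(\<exists>s. D f (pr x s)) \<longleftrightarrow> eval (Comp Zero c) f x = Some 0" for f x
    using exists_least_iff[of "\<lambda>s. D f (pr x s)"] unfolding c[symmetric] by (auto simp: bind_eq_Some_conv)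
  then show ?thesis by (rule ceI)
qed

section \<open>Finite strings as partial oracles and the use principle\<close>

definition tails :: "nat \<Rightarrow> nat" where "tails m = (if m = 0 then 0 else p2 (m - 1))"

definition string_oracle :: "nat \<Rightarrow> nat \<Rightarrow> nat" where
  "string_oracle s i = (if (tails ^^ i) s = 0 then 0 else Suc (p1 ((tails ^^ i) s - 1)))"

lemma string_oracle_eq:
  "string_oracle s i = (if i < length (list_decode s) then Suc (list_decode s ! i) else 0)"
proof -
  have "string_oracle (list_encode xs) i = (if i < length xs then Suc (xs ! i) else 0)" for xs
  proof (induction xs arbitrary: i)
    case Nil
    have "(tails ^^ i) 0 = 0" by (induction i) (auto simp: tails_def)
    then show ?case by (simp add: string_oracle_def)
  next
    case (Cons x xs)
    show ?case
    proof (cases i)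
      case (Suc j)
      have "(tails ^^ i) (list_encode (x # xs)) = (tails ^^ j) (list_encode xs)"
        unfolding Suc by (simp add: funpow_Suc_right tails_def del: funpow.simps)
      then have "string_oracle (list_encode (x # xs)) i = string_oracle (list_encode xs) j"
        unfolding string_oracle_def by (simp only:)
      then show ?thesis using Cons[of j] by (simp add: Suc del: list_encode.simps)
    qed (simp add: string_oracle_def)
  qed
  from this[of "list_decode s"] show ?thesis by simp
qed

lemma recursive_tails: "recursive a \<Longrightarrow> recursive (\<lambda>f x. tails (a f x))"
  unfolding tails_def by (intro recursive_intros)

lemma recursive_string_oracle:
  assumes "recursive a" "recursive b" shows "recursive (\<lambda>f x. string_oracle (a f x) (b f x))"
  unfolding string_oracle_def
  by (intro recursive_intros recursive_funpow[where G = "\<lambda>_ _. tails"] recursive_tails assms)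

lemma step_cong:
  assumes "ora' (p1 (p2 (p2 z))) = ora (p1 (p2 (p2 z)))" shows "step ora' z = step ora z"
  using assms by (simp add: step_def step_eval_def)

text \<open>A single step depends on the oracle at most at the position
  \<open>p1 (p2 (p2 z))\<close>, so \<open>n\<close> steps consult only a finite part of it.\<close>

lemma step_use:
  "\<exists>N. \<forall>ora'. (\<forall>x<N. ora' x = ora x) \<longrightarrow> (step ora' ^^ n) z = (step ora ^^ n) z"
proof (induction n arbitrary: z)
  case (Suc n)
  obtain N where N: "\<And>ora'. (\<forall>x<N. ora' x = ora x) \<Longrightarrow> (step ora' ^^ n) (step ora z) = (step ora ^^ n) (step ora z)"
    using Suc.IH by blast
  have "(step ora' ^^ Suc n) z = (step ora ^^ Suc n) z"
    if "\<forall>x<max N (Suc (p1 (p2 (p2 z)))). ora' x = ora x" for ora'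
    using that N[of ora'] step_cong[of ora' z ora] by (simp add: funpow_Suc_right tails_def del: funpow.simps)
  then show ?case by blast
qed simp

text \<open>The two runs can part only at a query that \<open>ora'\<close> leaves undefined; there
  the run over \<open>ora'\<close> is stuck forever and could not have halted.\<close>

lemma halts_mono:
  assumes "(step ora' ^^ n) z = Rt v 0" "\<And>x. ora' x \<noteq> 0 \<Longrightarrow> ora x = ora' x"
  shows "(step ora ^^ n) z = Rt v 0"
  using assms(1)
proof (induction n arbitrary: z)
  case (Suc n)
  show ?case
  proof (cases "step ora z = step ora' z")
    case True
    then show ?thesis using Suc by (simp add: funpow_Suc_right tails_def del: funpow.simps)
  next
    case False
    then have z: "p1 z = 0" "p1 (p2 z) = 4" and "ora (p1 (p2 (p2 z))) \<noteq> ora' (p1 (p2 (p2 z)))"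
      by (auto simp: step_def step_eval_def split: if_splits)
    then have "ora' (p1 (p2 (p2 z))) = 0" using assms(2) by metis
    then have "step ora' z = z"
      using z by (simp add: step_def step_eval_def Ev_def) (metis prod.collapse prod_decode_inverse)
    then have "(step ora' ^^ m) z = z" for m by (induction m) auto
    then have "z = Rt v 0" using Suc.prems by metis
    then show ?thesis using z by (simp add: Rt_def)
  qed
qed simp

text \<open>Forward, the string is an initial segment of \<open>f\<close> that covers the use of the
  run; backward, \<open>f\<close> extends the string as a partial oracle.\<close>

lemma halts_string:
  "(\<exists>n. (step (\<lambda>q. Suc (f q)) ^^ n) z = Rt v 0) \<longleftrightarrow>
   (\<exists>n s. (step (string_oracle s) ^^ n) z = Rt v 0 \<and> f \<in> cylinder (list_decode s))"
proof
  assume "\<exists>n. (step (\<lambda>q. Suc (f q)) ^^ n) z = Rt v 0"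
  then obtain n where n: "(step (\<lambda>q. Suc (f q)) ^^ n) z = Rt v 0" by blast
  obtain N where N: "\<And>ora'. (\<forall>x<N. ora' x = Suc (f x)) \<Longrightarrow> (step ora' ^^ n) z = (step (\<lambda>q. Suc (f q)) ^^ n) z"
    using step_use[of "\<lambda>q. Suc (f q)" n z] by blast
  have "(step (string_oracle (list_encode (map f [0..<N]))) ^^ n) z = Rt v 0"
    by (subst N) (simp_all add: string_oracle_eq n)
  moreover have "f \<in> cylinder (list_decode (list_encode (map f [0..<N])))"
    by (simp add: cylinder_def)
  ultimately show "\<exists>n s. (step (string_oracle s) ^^ n) z = Rt v 0 \<and> f \<in> cylinder (list_decode s)"
    by blast
next
  assume "\<exists>n s. (step (string_oracle s) ^^ n) z = Rt v 0 \<and> f \<in> cylinder (list_decode s)"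
  then obtain n s where "(step (string_oracle s) ^^ n) z = Rt v 0" "f \<in> cylinder (list_decode s)" by blast
  then have "(step (\<lambda>q. Suc (f q)) ^^ n) z = Rt v 0"
    by - (rule halts_mono[where ora' = "string_oracle s"], auto simp: string_oracle_eq cylinder_def split: if_splits)
  then show "\<exists>n. (step (\<lambda>q. Suc (f q)) ^^ n) z = Rt v 0" ..
qed

text \<open>Effective openness: \<open>w\<close> pairs a number of steps with a string. With the
  string as oracle the halting test no longer refers to \<open>f\<close>, which remains only in the
  cylinder.\<close>

lemma ce_cylinders:
  assumes "ce R"
  obtains D where "decidable (\<lambda>f. D)"
    "\<And>f x. R f x \<longleftrightarrow> (\<exists>w. D (pr x w) \<and> f \<in> cylinder (list_decode (p2 w)))"
proof -
  obtain c where c: "\<And>f x. R f x \<longleftrightarrow> eval (code_of (enc c)) f x = Some 0"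
    using assms unfolding code_of_enc by (rule ceE) blast
  let ?D = "\<lambda>z. (step (string_oracle (p2 (p2 z))) ^^ p1 (p2 z)) (Ev (enc c) (p1 z) 0) = Rt 0 0"
  have "decidable (\<lambda>f. ?D)"
    by (rule decidable_halts[where u = "\<lambda>_ z. p2 (p2 z)" and ora = "\<lambda>_. string_oracle"])
      (intro recursive_intros recursive_string_oracle)+
  moreover have "R f x \<longleftrightarrow> (\<exists>w. ?D (pr x w) \<and> f \<in> cylinder (list_decode (p2 w)))" for f x
  proof -
    have "R f x \<longleftrightarrow> (\<exists>n s. ?D (pr x (pr n s)) \<and> f \<in> cylinder (list_decode s))"
      unfolding c eval_iff_machine halts_string by simp
    also have "\<dots> \<longleftrightarrow> (\<exists>w. ?D (pr x w) \<and> f \<in> cylinder (list_decode (p2 w)))"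
      by (subst ex_pr[of "\<lambda>w. ?D (pr x w) \<and> f \<in> cylinder (list_decode (p2 w))"]) simp
    finally show ?thesis .
  qed
  ultimately show ?thesis by (rule that)
qed

lemma ce_decidable:
  assumes "ce R"
  obtains D where "decidable D" "\<And>f x. R f x \<longleftrightarrow> (\<exists>n. D f (pr x n))"
proof -
  obtain c where c: "\<And>f x. R f x \<longleftrightarrow> eval (code_of (enc c)) f x = Some 0"
    using assms unfolding code_of_enc by (rule ceE) blast
  let ?D = "\<lambda>f z. (step (\<lambda>q. Suc (f q)) ^^ p2 z) (Ev (enc c) (p1 z) 0) = Rt 0 0"
  have "decidable ?D"
    by (rule decidable_halts[where u = "\<lambda>_ _. 0" and ora = "\<lambda>f _ q. Suc (f q)"]) (intro recursive_intros)+
  moreover have "R f x \<longleftrightarrow> (\<exists>n. ?D f (pr x n))" for f x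
    unfolding c eval_iff_machine by simp
  ultimately show ?thesis by (rule that)
qed

lemma ce_conj: assumes "ce R" "ce S" shows "ce (\<lambda>f x. R f x \<and> S f x)"
proof -
  obtain D where D: "decidable D" "\<And>f x. R f x \<longleftrightarrow> (\<exists>n. D f (pr x n))"
    using ce_decidable[OF assms(1)] by blast
  obtain E where E: "decidable E" "\<And>f x. S f x \<longleftrightarrow> (\<exists>n. E f (pr x n))"
    using ce_decidable[OF assms(2)] by blast
  have "decidable (\<lambda>f z. D f (pr (p1 z) (p1 (p2 z))) \<and> E f (pr (p1 z) (p2 (p2 z))))"
    by (intro decidable_conj decidable_comp[OF D(1)] decidable_comp[OF E(1)] recursive_intros)
  from ce_ex_decidable[OF this] show ?thesis
    by (rule back_subst[of ce]) (intro ext, subst ex_pr, simp add: D(2) E(2))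
qed

text \<open>One of the two programs may diverge, so running them in turn would fail; witnesses for
  both are searched in parallel.\<close>

lemma ce_disj: assumes "ce R" "ce S" shows "ce (\<lambda>f x. R f x \<or> S f x)"
proof -
  obtain D where D: "decidable D" "\<And>f x. R f x \<longleftrightarrow> (\<exists>n. D f (pr x n))"
    using ce_decidable[OF assms(1)] by blast
  obtain E where E: "decidable E" "\<And>f x. S f x \<longleftrightarrow> (\<exists>n. E f (pr x n))"
    using ce_decidable[OF assms(2)] by blast
  have "decidable (\<lambda>f z. D f z \<or> E f z)" by (intro decidable_disj D E)
  from ce_ex_decidable[OF this] show ?thesis
    by (rule back_subst[of ce]) (auto simp: fun_eq_iff D(2) E(2))
qed

section \<open>Effective classes\<close>

lemma length_list_decode_le: "length (list_decode s) \<le> s"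
proof -
  have "length xs \<le> list_encode xs" for xs
  proof (induction xs)
    case (Cons x xs)
    then show ?case using le_prod_encode_2[of "list_encode xs" x] by simp
  qed simp
  from this[of "list_decode s"] show ?thesis by simp
qed

lemma decidable_cylinder: "decidable (\<lambda>f s. f \<in> cylinder (list_decode s))"
proof -
  let ?ok = "\<lambda>f s i. string_oracle s i = 0 \<or> string_oracle s i = Suc (f i)"
  \<comment> \<open>The code \<open>s\<close> bounds the length of the string it codes; positions
    beyond the end pass the test through the answer \<open>0\<close>.\<close>
  have "recursive (\<lambda>f s. rec_nat 1 (\<lambda>i r. if ?ok f s i then r else 0) s)"
    by (intro recursive_intros recursive_string_oracle)
  moreover have "rec_nat 1 (\<lambda>i r. if ?ok f s i then r else 0) m = (of_bool (\<forall>i<m. ?ok f s i) :: nat)" for f s m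
    by (induction m) (auto simp: less_Suc_eq)
  moreover have "(\<forall>i<s. ?ok f s i) \<longleftrightarrow> f \<in> cylinder (list_decode s)" for f s
    using length_list_decode_le[of s] by (auto simp: string_oracle_eq cylinder_def split: if_splits)
  ultimately show ?thesis unfolding decidable_def by (simp only:)
qed

text \<open>Course-of-values recursion: index \<open>e\<close> refers only to smaller indices, so
  \<open>T f e\<close> tabulates the truth values below \<open>e\<close>. The latest value comes
  first, hence index \<open>j\<close> is found at position \<open>k - 1 - j\<close> of a table of
  length \<open>k\<close>.\<close>

lemma decidable_Pi0_class: "decidable (\<lambda>f e. f \<in> Pi0_class e)"
proof -
  define chi where "chi f e = (of_bool (f \<in> Pi0_class e) :: nat)" for f e
  define look where "look r i = string_oracle r i - 1" for r i
  define X where "X f k r =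
    (if k mod 3 = 0 then of_bool (f \<in> cylinder (list_decode (k div 3)))
     else if k mod 3 = 1 then 1 - look r (k - 1 - k div 3)
     else look r (k - 1 - p1 (k div 3)) * look r (k - 1 - p2 (k div 3)))" for f k r
  define T where "T f e = rec_nat 0 (\<lambda>k r. Suc (pr (X f k r) r)) e" for f e
  have X: "recursive (\<lambda>f z. X f (a f z) (b f z))" if "recursive a" "recursive b" for a b
    unfolding X_def look_def
    by (intro recursive_intros recursive_string_oracle recursive_mod recursive_div that zero_less_numeral
        recursive_comp[OF decidable_cylinder[unfolded decidable_def]])
  have T: "T f e = list_encode (rev (map (chi f) [0..<e]))" for f e
  proof (induction e)
    case (Suc e)
    have look: "look (T f e) (e - 1 - k) = chi f k" if "k < e" for k
      using that by (simp add: look_def string_oracle_eq Suc.IH rev_nth)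
    have "X f e (T f e) = chi f e"
    proof -
      consider "e mod 3 = 0" | "e mod 3 = 1" | "e mod 3 = 2" by linarith
      then show ?thesis
      proof cases
        case 1
        then show ?thesis by (simp add: X_def chi_def Pi0_class.simps[of e])
      next
        case 2
        then have "e div 3 < e" by (cases e) auto
        from 2 look[OF this] show ?thesis by (simp add: X_def chi_def Pi0_class.simps[of e])
      next
        case 3
        then have "e div 3 < e" by (cases e) auto
        then have "p1 (e div 3) < e" "p2 (e div 3) < e"
          using fst_prod_decode_le snd_prod_decode_le by (meson le_less_trans)+
        from 3 this[THEN look] show ?thesis by (simp add: X_def chi_def Pi0_class.simps[of e])
      qed
    qed
    moreover have "T f (Suc e) = Suc (pr (X f e (T f e)) (T f e))" by (simp add: T_def)
    ultimately show ?case by (simp add: Suc.IH)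
  qed (simp add: T_def)
  have "recursive (\<lambda>f e. look (T f (Suc e)) 0)"
    unfolding look_def T_def by (intro recursive_intros recursive_string_oracle X)
  moreover have "look (T f (Suc e)) 0 = chi f e" for f e
    by (simp add: look_def string_oracle_eq T)
  ultimately show ?thesis unfolding decidable_def chi_def by simp
qed

text \<open>The quantifier prefix unfolded from \<^const>\<open>Pi_index\<close>; the quantified numbers accumulate in the argument.\<close>

primrec alt :: "nat \<Rightarrow> (nat \<Rightarrow> bool) \<Rightarrow> nat \<Rightarrow> bool" where
  "alt 0 P c \<longleftrightarrow> P c"
| "alt (Suc n) P c \<longleftrightarrow> (\<forall>x. \<not> alt n P (pr c x))"

text \<open>The additional quantifier is the innermost one and is vacuous; its negation cancels the
  one in the matrix.\<close>

lemma alt_dummy: "alt (Suc n) (\<lambda>c. \<not> R (p1 c)) i \<longleftrightarrow> alt n R i"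
  by (induction n arbitrary: i) simp_all

text \<open>Innermost, \<open>alt\<close> says \<open>\<forall>x. \<not> R (pr c x)\<close>, that
  is, there are no \<open>x\<close> and \<open>w\<close>; these two quantifiers merge into one over
  \<open>pr x w\<close>.\<close>

lemma alt_absorb:
  assumes "\<And>c. R c \<longleftrightarrow> (\<exists>w. S (pr (p1 c) (pr (p2 c) w)))"
  shows "alt (Suc n) R i \<longleftrightarrow> alt (Suc n) S i"
proof (induction n arbitrary: i)
  case 0
  have "(\<exists>z. S (pr i z)) \<longleftrightarrow> (\<exists>x w. S (pr i (pr x w)))" by (rule ex_pr)
  then show ?case by (auto simp: assms)
qed simp

lemma recursive_phi:
  assumes "recursive h" "recursive a" "\<And>f x. phi (h f x) (a f x) = Some (g f x)"
  shows "recursive g"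
proof -
  obtain U where U: "\<And>f e x. eval U f (pr e x) = eval (code_of e) f x" using universal_code by blast
  obtain c d where c: "\<And>f x. eval c f x = Some (h f x)" and d: "\<And>f x. eval d f x = Some (a f x)"
    using assms by (metis recursiveE)
  have "eval (psub Zero U) f (pr 0 x) = eval U (\<lambda>_. 0) x" for f x
    by (rule eval_psub) simp
  then show ?thesis using assms(3)
    by (intro recursiveI[of "Comp (psub Zero U) (Pair Zero (Pair c d))"]) (simp add: c d U phi_def Phi_def)
qed

text \<open>Forward, the universal program evaluates the nested indices level by level, adding one
  number to the argument each time. Backward, \<open>smn\<close> supplies indices for the sections
  \<open>j \<mapsto> h (pr i j)\<close>.\<close>

lemma uniformly_Pi_iff:
  "uniformly_Pi n V \<longleftrightarrow>
    (\<exists>P. recursive (\<lambda>f. P) \<and> (\<forall>i f. f \<in> V i \<longleftrightarrow> alt n (\<lambda>c. f \<in> Pi0_class (P c)) i))"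
proof
  have "\<exists>P. recursive (\<lambda>f. P) \<and> (\<forall>i f. f \<in> V i \<longleftrightarrow> alt n (\<lambda>c. f \<in> Pi0_class (P c)) i)"
    if "recursive (\<lambda>f. h)" "\<And>i. Pi_index n (h i) (V i)" for h
    using that
  proof (induction n arbitrary: h V)
    case 0
    then show ?case by auto
  next
    case (Suc n)
    have "\<forall>i. \<exists>H W. (\<forall>j. phi (h i) j = Some (H j)) \<and> (\<forall>j. Pi_index n (H j) (W j)) \<and> V i = (\<Inter>j. - W j)"
      using Suc.prems by simp
    then obtain H W where H: "\<And>i j. phi (h i) j = Some (H i j)" "\<And>i j. Pi_index n (H i j) (W i j)"
      "\<And>i. V i = (\<Inter>j. - W i j)" by metis
    have "recursive (\<lambda>f z. H (p1 z) (p2 z))"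
      by (rule recursive_phi[OF recursive_comp[OF Suc.prems(1) recursive_p1[OF recursive_id]]
            recursive_p2[OF recursive_id]]) (rule H)
    from Suc.IH[OF this, of "\<lambda>z. W (p1 z) (p2 z)"] H(2)
    obtain P where "recursive (\<lambda>f. P)" "\<And>z f. f \<in> W (p1 z) (p2 z) \<longleftrightarrow> alt n (\<lambda>c. f \<in> Pi0_class (P c)) z"
      by auto
    then show ?case by (intro exI[of _ P]) (simp add: H(3) flip: \<open>\<And>z f. f \<in> W (p1 z) (p2 z) \<longleftrightarrow> _ z f\<close>)
  qed
  then show "uniformly_Pi n V \<Longrightarrow> \<exists>P. recursive (\<lambda>f. P) \<and> (\<forall>i f. f \<in> V i \<longleftrightarrow> alt n (\<lambda>c. f \<in> Pi0_class (P c)) i)"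
    unfolding uniformly_Pi_def computable_iff_recursive by blast
next
  have "uniformly_Pi n V"
    if "recursive (\<lambda>f. P)" "\<And>i f. f \<in> V i \<longleftrightarrow> alt n (\<lambda>c. f \<in> Pi0_class (P c)) i" for P
    using that
  proof (induction n arbitrary: V)
    case 0
    then show ?case unfolding uniformly_Pi_def computable_iff_recursive by (intro exI[of _ P]) auto
  next
    case (Suc n)
    let ?W = "\<lambda>i. {f. alt n (\<lambda>c. f \<in> Pi0_class (P c)) i}"
    have "uniformly_Pi n ?W" by (rule Suc.IH[OF Suc.prems(1)]) simp
    then obtain h e where h: "\<And>i. Pi_index n (h i) (?W i)" and e: "\<And>x. phi e x = Some (h x)"
      unfolding uniformly_Pi_def computable_def by blast
    have "phi (smn e i) j = Some (h (pr i j))" for i j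
      using e by (simp add: phi_def Phi_def eval_smn)
    moreover have "V i = (\<Inter>j. - ?W (pr i j))" for i using Suc.prems(2) by auto
    ultimately have "Pi_index (Suc n) (smn e i) (V i)" for i
      unfolding Pi_index.simps
      by (intro exI[of _ "\<lambda>j. h (pr i j)"] exI[of _ "\<lambda>j. ?W (pr i j)"] conjI allI h) auto
    moreover have "recursive (\<lambda>f i. smn e i)" by (intro recursive_smn recursive_intros)
    ultimately show ?case unfolding uniformly_Pi_def computable_iff_recursive
      by (intro exI[of _ "smn e"]) simp
  qed
  then show "\<exists>P. recursive (\<lambda>f. P) \<and> (\<forall>i f. f \<in> V i \<longleftrightarrow> alt n (\<lambda>c. f \<in> Pi0_class (P c)) i) \<Longrightarrow> uniformly_Pi n V"
    by blast
qed

lemma Pi0_class_simps [simp]: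
  "Pi0_class 0 = UNIV" "Pi0_class (Suc 0) = {}"
  "Pi0_class (3 * k) = cylinder (list_decode k)" "Pi0_class (Suc (3 * k)) = - Pi0_class k"
proof -
  show "Pi0_class 0 = UNIV" "Pi0_class (3 * k) = cylinder (list_decode k)"
    by (subst Pi0_class.simps, simp add: cylinder_def)+
  show "Pi0_class (Suc (3 * k)) = - Pi0_class k" for k
  proof -
    have "Suc (3 * k) mod 3 = 1" "Suc (3 * k) div 3 = k" by presburger+
    then show ?thesis by (subst Pi0_class.simps) (simp only:, simp)
  qed
  from this[of 0] show "Pi0_class (Suc 0) = {}" using \<open>Pi0_class 0 = UNIV\<close> by simp
qed

lemma uniformly_Pi_Suc:
  assumes "uniformly_Pi n V" shows "uniformly_Pi (Suc n) V"
proof -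
  obtain P where P: "recursive (\<lambda>f. P)" "\<And>i f. f \<in> V i \<longleftrightarrow> alt n (\<lambda>c. f \<in> Pi0_class (P c)) i"
    using assms unfolding uniformly_Pi_iff by blast
  \<comment> \<open>Index \<open>Suc (3 * k)\<close> denotes the complement of class
    \<open>k\<close>, the negation that the vacuous quantifier cancels.\<close>
  have "recursive (\<lambda>f z. Suc (3 * P (p1 z)))"
    by (intro recursive_intros recursive_comp[OF P(1)])
  then show ?thesis unfolding uniformly_Pi_iff
    by (intro exI[of _ "\<lambda>z. Suc (3 * P (p1 z))"]) (simp add: alt_dummy[of n "\<lambda>c. _ \<in> Pi0_class (P c)"] P(2) del: alt.simps)
qed

section \<open>A normal form for the reducibilities\<close>

text \<open>Between finite levels the same cover is raised one level at a time; at
  \<open>\<infinity>\<close> any piece containing \<open>f\<close> supplies a functional.\<close>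

lemma red_mono: assumes "red m A B" "m \<le> n" shows "red n A B"
proof -
  have step: "red (enat (Suc k)) A B" if "red (enat k) A B" for k
    using that uniformly_Pi_Suc unfolding red_def enat.simps by blast
  have fin: "red (enat (k + l)) A B" if "red (enat k) A B" for k l
  proof (induction l)
    case (Suc l)
    then show ?case using step[of "k + l"] by simp
  qed (use that in simp)
  have inf: "red \<infinity> A B" if "red (enat k) A B" for k
    using that unfolding red_def enat.simps by blast
  show ?thesis
  proof (cases m)
    case (enat k)
    show ?thesis
    proof (cases n)
      case (enat l)
      with assms \<open>m = enat k\<close> fin[of k "l - k"] show ?thesis by simp
    next
      case infinity
      with assms \<open>m = enat k\<close> inf show ?thesis by simp
    qed
  next
    case infinity
    with assms show ?thesis by simp
  qed
qed

lemma red_0I: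
  assumes "\<And>f. f \<in> B \<Longrightarrow> \<exists>g\<in>A. \<forall>x. eval c f x = Some (g x)" shows "red 0 A B"
proof -
  have "uniformly_Pi 0 (\<lambda>i. UNIV)"
    unfolding uniformly_Pi_iff by (intro exI[of _ "\<lambda>_. 0"]) (simp add: recursive_const)
  moreover have "computable (\<lambda>i. enc c)"
    unfolding computable_iff_recursive by (rule recursive_const)
  moreover have "Phi_in (enc c) f A" if "f \<in> B" for f
    using assms[OF that] by (simp add: Phi_in_def Phi_def code_of_enc)
  ultimately show ?thesis
    unfolding zero_enat_def red_def by auto
qed

lemma red_0_recursive:
  assumes "recursive F" "\<And>f. f \<in> B \<Longrightarrow> F f \<in> A" shows "red 0 A B"
proof -
  obtain c where "\<And>f x. eval c f x = Some (F f x)" using assms(1) by (rule recursiveE) blast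
  then show ?thesis using assms(2) by (intro red_0I[of _ _ c]) auto
qed

lemma red_refl: "red n A A"
  by (rule red_mono[of 0]) (auto intro: red_0_recursive recursive_basic)

text \<open>
  The matrix \<open>R\<close> of the cover is only required to be c.e.: for \<open>n > 0\<close> its existential quantifier is
  absorbed by the innermost universal one, and for \<open>n = 0\<close> a suitable piece of the cover can be searched for.
\<close>

definition good ::
  "nat \<Rightarrow> ((nat \<Rightarrow> nat) \<Rightarrow> nat \<Rightarrow> bool) \<Rightarrow> code \<Rightarrow> (nat \<Rightarrow> nat) \<Rightarrow> (nat \<Rightarrow> nat) set \<Rightarrow> bool" where
  "good n R d f A \<longleftrightarrow> (\<exists>i. alt n (R f) i) \<and>
     (\<forall>i. alt n (R f) i \<longrightarrow> (\<exists>g\<in>A. \<forall>x. eval d f (pr i x) = Some (g x)))"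

text \<open>Membership in a \<open>Pi0_class\<close> is decidable, and the universal program joins
  the sequence of functionals into one program \<open>d\<close> that takes the piece as a
  parameter.\<close>

lemma red_enatE:
  assumes "red (enat n) A B"
  obtains R d where "ce R" "\<And>f. f \<in> B \<Longrightarrow> good n R d f A"
proof -
  obtain V e where V: "uniformly_Pi n V" "B \<subseteq> (\<Union>i. V i)" "computable e"
    "\<And>i f. f \<in> B \<Longrightarrow> f \<in> V i \<Longrightarrow> Phi_in (e i) f A"
    using assms unfolding red_def by auto
  obtain P where P: "recursive (\<lambda>f. P)" "\<And>i f. f \<in> V i \<longleftrightarrow> alt n (\<lambda>c. f \<in> Pi0_class (P c)) i"
    using V(1) unfolding uniformly_Pi_iff by blast
  obtain U where U: "\<And>f e x. eval U f (pr e x) = eval (code_of e) f x" using universal_code by blast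
  obtain c where c: "\<And>f x. eval c f x = Some (e x)"
    using V(3) unfolding computable_iff_recursive by (rule recursiveE) blast
  let ?R = "\<lambda>f c. f \<in> Pi0_class (P c)"
  have "decidable ?R" by (rule decidable_comp[OF decidable_Pi0_class P(1)])
  from decidable_not[OF this] obtain t where "\<And>f x. eval t f x = Some (of_bool (\<not> ?R f x))"
    unfolding decidable_def by (rule recursiveE) blast
  then have "ce ?R" by (intro ceI[of _ t]) simp
  moreover have "good n ?R (Comp U (Pair (Comp c Left) Right)) f A" if "f \<in> B" for f
    unfolding good_def P(2)[symmetric] using V(2) V(4) that
    by (auto simp: Phi_in_def Phi_def c U)
  ultimately show ?thesis by (rule that)
qed

text \<open>Search for \<open>k = pr i n\<close> such that \<open>n\<close> witnesses
  \<open>R f i\<close>, then run \<open>d\<close> for the piece \<open>i\<close>. This is a single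
  functional, so the trivial cover suffices.\<close>

lemma red_enatI_0:
  assumes "ce R" "\<And>f. f \<in> B \<Longrightarrow> good 0 R d f A"
  shows "red 0 A B"
proof -
  obtain D where D: "decidable D" "\<And>f x. R f x \<longleftrightarrow> (\<exists>n. D f (pr x n))"
    using ce_decidable[OF assms(1)] by blast
  have "decidable (\<lambda>f z. D f (p2 z))" by (intro decidable_comp[OF D(1)] recursive_intros)
  then obtain c where "\<And>f x k. eval c f x = Some k \<longleftrightarrow> D f (p2 (pr x k)) \<and> (\<forall>j<k. \<not> D f (p2 (pr x j)))"
    by (rule decidable_search) blast
  then have c: "\<And>f x k. eval c f x = Some k \<longleftrightarrow> D f k \<and> (\<forall>j<k. \<not> D f j)" by simp
  show ?thesis
  proof (rule red_0I[where c = "Comp d (Pair (Comp Left (Comp c Zero)) (Pair Left Right))"])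
    fix f assume "f \<in> B"
    with assms(2) have g: "good 0 R d f A" .
    then obtain i where "R f i" by (auto simp: good_def)
    then have "\<exists>k. D f k" unfolding D by blast
    from exists_least_iff[THEN iffD1, OF this] obtain k where k: "eval c f 0 = Some k" unfolding c by blast
    then have "R f (p1 k)" unfolding c D by (metis prod.collapse prod_decode_inverse)
    with g show "\<exists>g\<in>A. \<forall>x. eval (Comp d (Pair (Comp Left (Comp c Zero)) (Pair Left Right))) f x = Some (g x)"
      using k by (simp add: good_def)
  qed
qed

lemma red_enatI_Suc:
  assumes "ce R" "\<And>f. f \<in> B \<Longrightarrow> good (Suc m) R d f A"
  shows "red (enat (Suc m)) A B"
proof -
  obtain D where D: "decidable (\<lambda>f. D)"
    "\<And>f x. R f x \<longleftrightarrow> (\<exists>w. D (pr x w) \<and> f \<in> cylinder (list_decode (p2 w)))"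
    using ce_cylinders[OF assms(1)] by blast
  \<comment> \<open>\<open>?c\<close> turns \<open>pr c (pr x w)\<close> into
    \<open>pr (pr c x) w\<close>, undoing the regrouping in \<open>alt_absorb\<close>. Where
    \<open>D\<close> fails, index 1, the empty class, keeps \<open>w\<close> from being a
    witness.\<close>
  let ?c = "\<lambda>z. pr (pr (p1 z) (p1 (p2 z))) (p2 (p2 z))"
  let ?P = "\<lambda>z. if D (?c z) then 3 * p2 (p2 (p2 z)) else 1"
  let ?V = "\<lambda>i. {f. alt (Suc m) (R f) i}"
  have "recursive (\<lambda>f. ?P)" by (intro recursive_intros decidable_comp[OF D(1)])
  moreover have "alt (Suc m) (R f) i \<longleftrightarrow> alt (Suc m) (\<lambda>z. f \<in> Pi0_class (?P z)) i" for f i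
    by (rule alt_absorb) (auto simp: D(2))
  ultimately have "uniformly_Pi (Suc m) ?V"
    unfolding uniformly_Pi_iff by (intro exI[of _ ?P]) (simp del: alt.simps)
  moreover have "B \<subseteq> (\<Union>i. ?V i)" using assms(2) by (auto simp: good_def simp del: alt.simps)
  moreover have "computable (smn (enc d))"
    unfolding computable_iff_recursive by (intro recursive_smn recursive_id)
  moreover have "\<forall>i. \<forall>f\<in>B \<inter> ?V i. Phi_in (smn (enc d) i) f A"
    using assms(2) by (auto simp: good_def Phi_in_def Phi_def eval_smn code_of_enc simp del: alt.simps)
  ultimately show ?thesis unfolding red_def enat.simps by blast
qed

lemma red_enatI:
  assumes "ce R" "\<And>f. f \<in> B \<Longrightarrow> good n R d f A"
  shows "red (enat n) A B"
proof (cases n)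
  case 0
  then show ?thesis using red_enatI_0[OF assms(1), of B d A] assms(2) by (simp flip: zero_enat_def)
next
  case (Suc m)
  then show ?thesis using red_enatI_Suc[OF assms(1), of B m d A] assms(2) by simp
qed

section \<open>Merging quantifier prefixes, and transitivity\<close>

definition and_or :: "bool \<Rightarrow> bool \<Rightarrow> bool \<Rightarrow> bool" where
  "and_or b p q \<longleftrightarrow> (if b then p \<and> q else p \<or> q)"

primrec root :: "nat \<Rightarrow> nat \<Rightarrow> nat" where
  "root 0 c = c"
| "root (Suc k) c = root k (p1 c)"

text \<open>If \<open>c\<close> arises from a pair by appending \<open>k\<close> numbers, each
  itself a pair, then \<open>projl\<close> and \<open>projr\<close> give the arguments accumulated
  by the two separate prefixes, and \<open>root\<close> gives back the initial pair.\<close>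

primrec projl :: "nat \<Rightarrow> nat \<Rightarrow> nat" where
  "projl 0 c = p1 c"
| "projl (Suc k) c = pr (projl k (p1 c)) (p1 (p2 c))"

primrec projr :: "nat \<Rightarrow> nat \<Rightarrow> nat" where
  "projr 0 c = p2 c"
| "projr (Suc k) c = pr (projr k (p1 c)) (p2 (p2 c))"

lemma recursive_root: "recursive a \<Longrightarrow> recursive (\<lambda>f x. root k (a f x))"
  by (induction k arbitrary: a) (simp_all add: recursive_p1)

lemma recursive_projl: "recursive a \<Longrightarrow> recursive (\<lambda>f x. projl k (a f x))"
  by (induction k arbitrary: a) (simp_all add: recursive_p1 recursive_p2 recursive_pr)

lemma recursive_projr: "recursive a \<Longrightarrow> recursive (\<lambda>f x. projr k (a f x))"
  by (induction k arbitrary: a) (simp_all add: recursive_p1 recursive_p2 recursive_pr)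

lemmas recursive_proj = recursive_root recursive_projl recursive_projr

lemma all_pr: "(\<forall>z. P z) \<longleftrightarrow> (\<forall>a b. P (pr a b))"
  by (metis prod.collapse prod_decode_inverse)

text \<open>
  Merging two prefixes quantifier by quantifier: passing a negation swaps conjunction and disjunction, so
  the connective in the matrix depends on the parity of \<open>n\<close>.
\<close>

lemma alt_and_or:
  "alt n (\<lambda>c. and_or (b \<longleftrightarrow> even n) (R (projl (k + n) c)) (S (root (k + n) c) (projr (k + n) c))) c \<longleftrightarrow>
   and_or b (alt n R (projl k c)) (alt n (S (root k c)) (projr k c))"
proof (induction n arbitrary: b k c)
  case 0
  then show ?case by simp
next
  case (Suc n)
  let ?T = "\<lambda>c. and_or (b \<longleftrightarrow> even (Suc n)) (R (projl (k + Suc n) c)) (S (root (k + Suc n) c) (projr (k + Suc n) c))"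
  have "?T = (\<lambda>c. and_or ((\<not> b) \<longleftrightarrow> even n) (R (projl (Suc k + n) c)) (S (root (Suc k + n) c) (projr (Suc k + n) c)))"
  proof -
    have "(b \<longleftrightarrow> even (Suc n)) = ((\<not> b) \<longleftrightarrow> even n)" by auto
    then show ?thesis by (simp only: add_Suc_right add_Suc)
  qed
  then have "alt n ?T (pr c z) \<longleftrightarrow>
      and_or (\<not> b) (alt n R (pr (projl k c) (p1 z))) (alt n (S (root k c)) (pr (projr k c) (p2 z)))" for z
    using Suc.IH[of "\<not> b" "Suc k" "pr c z"] by simp
  then have "alt (Suc n) ?T c \<longleftrightarrow>
      (\<forall>z. \<not> and_or (\<not> b) (alt n R (pr (projl k c) (p1 z))) (alt n (S (root k c)) (pr (projr k c) (p2 z))))"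
    by simp
  \<comment> \<open>The two halves of \<open>z\<close> vary independently, so the quantifiers
    distribute over either connective.\<close>
  also have "\<dots> \<longleftrightarrow> (\<forall>x y. \<not> and_or (\<not> b) (alt n R (pr (projl k c) x)) (alt n (S (root k c)) (pr (projr k c) y)))"
    by (subst all_pr) simp
  also have "\<dots> \<longleftrightarrow> and_or b (alt (Suc n) R (projl k c)) (alt (Suc n) (S (root k c)) (projr k c))"
    by (auto simp: and_or_def)
  finally show ?case .
qed

text \<open>\<open>S\<close> may depend on the initial pair: in a composition the second cover is
  evaluated at the output of the functional chosen by the first.\<close>

lemma alt_conj:
  "alt n (\<lambda>c. and_or (even n) (R (projl n c)) (S (root n c) (projr n c))) c \<longleftrightarrow>
   alt n R (p1 c) \<and> alt n (S c) (p2 c)"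
  using alt_and_or[of n True R 0 S c] by (simp add: and_or_def)

lemma ce_and_or: "ce R \<Longrightarrow> ce S \<Longrightarrow> ce (\<lambda>f x. and_or b (R f x) (S f x))"
  by (cases b) (simp_all add: and_or_def ce_conj ce_disj)

text \<open>Piece \<open>pr j i\<close> of the composed cover: \<open>f\<close> lies in piece
  \<open>j\<close> of the first cover and its image under that functional in piece \<open>i\<close>
  of the second. Substitution makes the second condition c.e. in \<open>f\<close>; pairs whose first
  functional diverges are excluded by the first condition.\<close>

lemma red_trans_enat:
  assumes "red (enat n) A B" "red (enat n) B C" shows "red (enat n) A C"
proof -
  obtain R d where R: "ce R" "\<And>f. f \<in> C \<Longrightarrow> good n R d f B" using assms(2) by (rule red_enatE) blast
  obtain R0 d0 where R0: "ce R0" "\<And>f. f \<in> B \<Longrightarrow> good n R0 d0 f A" using assms(1) by (rule red_enatE) blast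
  obtain t where t: "\<And>f x. R0 f x \<longleftrightarrow> eval t f x = Some 0" using R0(1) by (rule ceE) blast
  let ?S = "\<lambda>f j c. eval (psub d t) f (pr (p1 j) c) = Some 0"
  let ?R = "\<lambda>f c. and_or (even n) (R f (projl n c)) (?S f (root n c) (projr n c))"
  let ?d = "Comp (psub d d0) (Pair (Comp Left Left) (Pair (Comp Right Left) Right))"
  have ce: "ce (\<lambda>f x. eval (psub d t) f x = Some 0)" by (rule ceI[of _ "psub d t"]) simp
  have "ce ?R"
    by (intro ce_and_or ce_comp[OF R(1)] ce_comp[OF ce] recursive_proj recursive_intros)
  moreover have "good n ?R ?d f A" if "f \<in> C" for f
  proof -
    note f = R(2)[OF that]
    have rel: "\<exists>g\<in>B. (\<forall>c. ?S f (pr j i) c \<longleftrightarrow> R0 g c) \<and> (\<forall>x. eval ?d f (pr (pr j i) x) = eval d0 g (pr i x))"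
      if j: "alt n (R f) j" for i j
    proof -
      obtain g where g: "g \<in> B" "\<And>x. eval d f (pr j x) = Some (g x)" using f j by (auto simp: good_def)
      have "eval (psub d c) f (pr j x) = eval c g x" for c x by (rule eval_psub) (rule g)
      with g(1) show ?thesis by (intro bexI[of _ g]) (auto simp: t)
    qed
    have alt: "alt n (?R f) (pr j i) \<longleftrightarrow> alt n (R f) j \<and> alt n (?S f (pr j i)) i" for i j
      using alt_conj[of n "R f" "?S f" "pr j i"] by simp
    obtain j where j: "alt n (R f) j" using f by (auto simp: good_def)
    from rel[OF j, of 0] obtain g where g: "g \<in> B" "\<And>i c. ?S f (pr j i) c \<longleftrightarrow> R0 g c" by auto
    from R0(2)[OF g(1)] obtain i where "alt n (R0 g) i" by (auto simp: good_def)
    then have "alt n (?R f) (pr j i)" unfolding alt using j g(2) by (simp add: fun_eq_iff)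
    moreover have "\<exists>h\<in>A. \<forall>x. eval ?d f (pr z x) = Some (h x)" if "alt n (?R f) z" for z
    proof -
      obtain j i where z: "z = pr j i" by (metis prod.collapse prod_decode_inverse)
      with that have ji: "alt n (R f) j" "alt n (?S f (pr j i)) i" using alt by auto
      from rel[OF ji(1), of i] obtain g where g: "g \<in> B" "?S f (pr j i) = R0 g"
        "\<And>x. eval ?d f (pr (pr j i) x) = eval d0 g (pr i x)" by auto
      with R0(2)[OF g(1)] ji(2) show ?thesis unfolding z good_def g(3) g(2) by blast
    qed
    ultimately show ?thesis unfolding good_def by blast
  qed
  ultimately show ?thesis by (rule red_enatI)
qed

lemma red_infinity_iff:
  "red \<infinity> A B \<longleftrightarrow> (\<forall>f\<in>B. \<exists>c. \<exists>g\<in>A. \<forall>x. eval c f x = Some (g x))"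
  unfolding red_def enat.simps Phi_in_def Phi_def by (metis code_of_enc)

lemma red_trans [trans]:
  assumes "red n A B" "red n B C" shows "red n A C"
proof (cases n)
  case (enat k)
  then show ?thesis using red_trans_enat assms by blast
next
  case infinity
  show ?thesis unfolding infinity red_infinity_iff
  proof
    fix f assume "f \<in> C"
    then obtain c g where g: "g \<in> B" "\<And>x. eval c f x = Some (g x)"
      using assms(2) unfolding infinity red_infinity_iff by blast
    obtain d h where h: "h \<in> A" "\<And>x. eval d g x = Some (h x)"
      using assms(1) g(1) unfolding infinity red_infinity_iff by blast
    have "eval (psub (Comp c Right) d) f (pr 0 x) = eval d g x" for x by (rule eval_psub) (simp add: g)
    then show "\<exists>c. \<exists>g\<in>A. \<forall>x. eval c f x = Some (g x)"
      by (intro exI[of _ "Comp (psub (Comp c Right) d) (Pair Zero (Pair Left Right))"] bexI[OF _ h(1)])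
        (simp add: h)
  qed
qed

section \<open>Joins and implications\<close>

lemma red_mass_join1: "red n A (mass_join A B)"
proof (rule red_mono[of 0])
  have "recursive (\<lambda>f x. f (2 * x))" by (intro recursive_intros)
  then show "red 0 A (mass_join A B)"
    by (rule red_0_recursive) (auto simp: mass_join_def fun_join_def)
qed simp

lemma red_mass_join2: "red n B (mass_join A B)"
proof (rule red_mono[of 0])
  have "recursive (\<lambda>f x. f (Suc (2 * x)))" by (intro recursive_intros)
  then show "red 0 B (mass_join A B)"
    by (rule red_0_recursive) (auto simp: mass_join_def fun_join_def)
qed simp

lemma join_code:
  obtains c where "\<And>f p x g h. (\<And>y. eval c1 f (pr p y) = Some (g y)) \<Longrightarrow> (\<And>y. eval c2 f (pr p y) = Some (h y)) \<Longrightarrow>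
    eval c f (pr p x) = Some (fun_join g h x)"
proof -
  have "recursive (\<lambda>f z. if p2 z mod 2 = 0 then p1 (p1 z) else p2 (p1 z))"
    by (intro recursive_intros recursive_mod) simp
  then obtain s where s: "\<And>f z. eval s f z = Some (if p2 z mod 2 = 0 then p1 (p1 z) else p2 (p1 z))"
    by (rule recursiveE) blast
  have "recursive (\<lambda>f z. pr (p1 z) (p2 z div 2))" by (intro recursive_intros recursive_div) simp
  then obtain q where q: "\<And>f z. eval q f z = Some (pr (p1 z) (p2 z div 2))"
    by (rule recursiveE) blast
  show ?thesis
    by (rule that[of "Comp s (Pair (Pair (Comp c1 q) (Comp c2 q)) Right)"])
      (simp add: s q fun_join_def even_iff_mod_2_eq_zero)
qed

text \<open>Common refinement of the covers: piece \<open>z\<close> is the intersection of the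
  pieces \<open>p1 z\<close> and \<open>p2 z\<close>, and merging prefixes keeps it at level
  \<open>n\<close>.\<close>

lemma red_mass_join_enat:
  assumes "red (enat n) A X" "red (enat n) B X" shows "red (enat n) (mass_join A B) X"
proof -
  obtain R d where R: "ce R" "\<And>f. f \<in> X \<Longrightarrow> good n R d f A" using assms(1) by (rule red_enatE) blast
  obtain S e where S: "ce S" "\<And>f. f \<in> X \<Longrightarrow> good n S e f B" using assms(2) by (rule red_enatE) blast
  let ?d = "Comp d (Pair (Comp Left Left) Right)" and ?e = "Comp e (Pair (Comp Right Left) Right)"
  obtain c where c: "\<And>f p x g h. (\<And>y. eval ?d f (pr p y) = Some (g y)) \<Longrightarrow> (\<And>y. eval ?e f (pr p y) = Some (h y)) \<Longrightarrow>
    eval c f (pr p x) = Some (fun_join g h x)"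
    by (rule join_code) blast
  let ?R = "\<lambda>f c. and_or (even n) (R f (projl n c)) (S f (projr n c))"
  have "ce ?R" by (intro ce_and_or ce_comp[OF R(1)] ce_comp[OF S(1)] recursive_proj recursive_intros)
  moreover have "good n ?R c f (mass_join A B)" if "f \<in> X" for f
  proof -
    have alt: "alt n (?R f) z \<longleftrightarrow> alt n (R f) (p1 z) \<and> alt n (S f) (p2 z)" for z
      using alt_conj[of n "R f" "\<lambda>_. S f" z] .
    obtain i j where "alt n (R f) i" "alt n (S f) j" using R(2)[OF \<open>f \<in> X\<close>] S(2)[OF \<open>f \<in> X\<close>] by (auto simp: good_def)
    then have "alt n (?R f) (pr i j)" by (simp add: alt)
    moreover have "\<exists>k\<in>mass_join A B. \<forall>x. eval c f (pr z x) = Some (k x)" if z: "alt n (?R f) z" for z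
    proof -
      obtain g where g: "g \<in> A" "\<And>x. eval d f (pr (p1 z) x) = Some (g x)"
        using z R(2)[OF \<open>f \<in> X\<close>] unfolding alt good_def by blast
      obtain h where h: "h \<in> B" "\<And>x. eval e f (pr (p2 z) x) = Some (h x)"
        using z S(2)[OF \<open>f \<in> X\<close>] unfolding alt good_def by blast
      have "eval c f (pr z x) = Some (fun_join g h x)" for x by (rule c) (simp_all add: g h)
      moreover have "fun_join g h \<in> mass_join A B" using g h by (auto simp: mass_join_def)
      ultimately show ?thesis by blast
    qed
    ultimately show ?thesis unfolding good_def by blast
  qed
  ultimately show ?thesis by (rule red_enatI)
qed

lemma red_mass_join_infinity:
  assumes "red \<infinity> A X" "red \<infinity> B X" shows "red \<infinity> (mass_join A B) X"
  unfolding red_infinity_iff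
proof
  fix f assume f: "f \<in> X"
  obtain d g where g: "g \<in> A" "\<And>x. eval d f x = Some (g x)"
    using assms(1) f unfolding red_infinity_iff by blast
  obtain e h where h: "h \<in> B" "\<And>x. eval e f x = Some (h x)"
    using assms(2) f unfolding red_infinity_iff by blast
  obtain c where c: "\<And>f p x g h. (\<And>y. eval (Comp d Right) f (pr p y) = Some (g y)) \<Longrightarrow>
    (\<And>y. eval (Comp e Right) f (pr p y) = Some (h y)) \<Longrightarrow>
    eval c f (pr p x) = Some (fun_join g h x)"
    by (rule join_code) blast
  have "eval c f (pr 0 x) = Some (fun_join g h x)" for x by (rule c) (simp_all add: g h)
  moreover have "fun_join g h \<in> mass_join A B" using g h by (auto simp: mass_join_def)
  ultimately show "\<exists>c. \<exists>k\<in>mass_join A B. \<forall>x. eval c f x = Some (k x)"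
    by (intro exI[of _ "Comp c (Pair Zero (Pair Left Right))"] bexI[of _ "fun_join g h"]) simp_all
qed

lemma red_mass_join_iff: "red n (mass_join A B) X \<longleftrightarrow> red n A X \<and> red n B X"
  using red_trans[OF red_mass_join1] red_trans[OF red_mass_join2]
    red_mass_join_enat red_mass_join_infinity by (metis enat.exhaust)

lemma red_mass_join_mono: "red n A A' \<Longrightarrow> red n B B' \<Longrightarrow> red n (mass_join A B) (mass_join A' B')"
  unfolding red_mass_join_iff by (meson red_trans red_mass_join1 red_mass_join2)

section \<open>Uniform representatives and implications\<close>

definition index_good :: "nat \<Rightarrow> nat \<Rightarrow> (nat \<Rightarrow> nat) \<Rightarrow> (nat \<Rightarrow> nat) set \<Rightarrow> bool" where
  "index_good n r f A \<longleftrightarrow> good n (\<lambda>f c. eval (code_of (p1 r)) f c = Some 0) (code_of (p2 r)) f A"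

lemma red_enat_index:
  assumes "red (enat n) A B" obtains r where "\<And>f. f \<in> B \<Longrightarrow> index_good n r f A"
proof -
  obtain R d where R: "ce R" "\<And>f. f \<in> B \<Longrightarrow> good n R d f A" using assms by (rule red_enatE) blast
  obtain t where t: "\<And>f x. R f x \<longleftrightarrow> eval t f x = Some 0" using R(1) by (rule ceE) blast
  have "R = (\<lambda>f x. eval t f x = Some 0)" using t by (intro ext) blast
  with R(2) show ?thesis
    by (intro that[of "pr (enc t) (enc d)"]) (simp add: index_good_def code_of_enc)
qed

text \<open>The index may be computed from the oracle itself: the universal program, run over
  \<open>G f\<close> by substitution, evaluates both matrix and functional. As this evaluation can
  diverge, it matters that a c.e. matrix is allowed.\<close>

lemma red_enat_uniform:
  assumes "recursive (\<lambda>f x. r f)" "recursive G" "\<And>f. f \<in> B \<Longrightarrow> index_good n (r f) (G f) A"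
  shows "red (enat n) A B"
proof -
  obtain U where U: "\<And>f e x. eval U f (pr e x) = eval (code_of e) f x" using universal_code by blast
  obtain c where c: "\<And>f x. eval c f x = Some (r f)" using assms(1) by (rule recursiveE) blast
  obtain g where g: "\<And>f x. eval g f x = Some (G f x)" using assms(2) by (rule recursiveE) blast
  have rel: "eval (psub (Comp g Right) U) f (pr 0 (pr e x)) = eval (code_of e) (G f) x" for f e x
    unfolding U[symmetric] by (rule eval_psub) (simp add: g)
  let ?t = "Comp (psub (Comp g Right) U) (Pair Zero (Pair (Comp Left c) (Pair Left Right)))"
  let ?d = "Comp (psub (Comp g Right) U) (Pair Zero (Pair (Comp Right c) (Pair Left Right)))"
  have t: "eval ?t f x = eval (code_of (p1 (r f))) (G f) x" for f x by (simp add: c rel)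
  have d: "eval ?d f x = eval (code_of (p2 (r f))) (G f) x" for f x by (simp add: c rel)
  have "ce (\<lambda>f x. eval ?t f x = Some 0)" by (rule ceI[of _ ?t]) simp
  moreover have "good n (\<lambda>f x. eval ?t f x = Some 0) ?d f A" if "f \<in> B" for f
    using assms(3)[OF that] unfolding good_def index_good_def t d .
  ultimately show ?thesis by (rule red_enatI)
qed

lemma red_0_case_nat:
  assumes "\<And>f. f \<in> X \<Longrightarrow> case_nat r f \<in> A" shows "red 0 A X"
proof -
  have "recursive (\<lambda>f x. if x = 0 then r else f (x - 1))" by (intro recursive_intros)
  moreover have "(\<lambda>x. if x = 0 then r else f (x - 1)) = case_nat r f" for f :: "nat \<Rightarrow> nat"
    by (auto split: nat.split)
  ultimately show ?thesis using assms by (intro red_0_recursive[of "\<lambda>f. case_nat r f"]) simp_all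
qed

text \<open>The first entry of an element of \<open>u A\<close> is an index for the rest. An index
  of a reduction to \<open>X\<close> is the same for all points of \<open>X\<close>, so prefixing it
  is one functional and has level 0.\<close>

lemma uniform_representative:
  "\<exists>u. \<forall>A X. red n A (u A) \<and> (red n A X \<longrightarrow> red 0 (u A) X)"
proof (cases n)
  case (enat k)
  define u where "u A = {case_nat r f | r f. index_good k r f A}" for A
  have "red n A (u A)" for A unfolding enat
  proof (rule red_enat_uniform)
    show "recursive (\<lambda>f x. f 0)" "recursive (\<lambda>f x. f (Suc x))" by (intro recursive_intros)+
  qed (auto simp: u_def)
  moreover have "red 0 (u A) X" if X: "red n A X" for A X
  proof -
    obtain r where "\<And>f. f \<in> X \<Longrightarrow> index_good k r f A"
      using X unfolding enat by (rule red_enat_index) blast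
    then show ?thesis by (intro red_0_case_nat[of _ r]) (auto simp: u_def)
  qed
  ultimately show ?thesis by blast
next
  case infinity
  define u where "u A = {f. \<exists>c. \<exists>g\<in>A. \<forall>x. eval c f x = Some (g x)}" for A :: "(nat \<Rightarrow> nat) set"
  have "red n A (u A)" for A unfolding infinity red_infinity_iff by (simp add: u_def)
  moreover have "red 0 (u A) X" if "red n A X" for A X
    using that unfolding infinity red_infinity_iff
    by (intro red_0_recursive[of "\<lambda>f. f"] recursive_basic) (auto simp: u_def)
  ultimately show ?thesis by blast
qed

lemma implication_exists:
  "\<exists>D. \<forall>X. red n D X \<longleftrightarrow> red n B (mass_join A X)"
proof -
  \<comment> \<open>It suffices that \<open>D\<close> is itself a solution and lies below every
    solution, even at level 0; monotonicity of joins gives the equivalence.\<close>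
  have "\<exists>D. red n B (mass_join A D) \<and> (\<forall>X. red n B (mass_join A X) \<longrightarrow> red 0 D X)"
  proof (cases n)
    case (enat k)
    define D where "D = {case_nat r f | r f. \<forall>g\<in>A. index_good k r (fun_join g f) B}"
    have "red n B (mass_join A D)" unfolding enat
    proof (rule red_enat_uniform)
      \<comment> \<open>In the join of \<open>g\<close> with \<open>case_nat r f\<close> the index
        \<open>r\<close> stands at position 1; shifting the odd positions by 2 removes it and leaves
        \<open>fun_join g f\<close>.\<close>
      show "recursive (\<lambda>f x. f 1)" by (intro recursive_intros)
      show "recursive (\<lambda>f x. if x mod 2 = 0 then f x else f (x + 2))"
        by (intro recursive_intros recursive_mod) simp
      fix F assume "F \<in> mass_join A D"
      then obtain g r f where F: "F = fun_join g (case_nat r f)" "index_good k r (fun_join g f) B"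
        by (auto simp: mass_join_def D_def)
      have "(\<lambda>x. if x mod 2 = 0 then F x else F (x + 2)) = fun_join g f"
        by (auto simp: fun_join_def F(1) fun_eq_iff even_iff_mod_2_eq_zero)
      then show "index_good k (F 1) (\<lambda>x. if x mod 2 = 0 then F x else F (x + 2)) B"
        using F(2) by (simp add: F(1) fun_join_def)
    qed
    moreover have "red 0 D X" if X: "red n B (mass_join A X)" for X
    proof -
      obtain r where "\<And>f. f \<in> mass_join A X \<Longrightarrow> index_good k r f B"
        using X unfolding enat by (rule red_enat_index) blast
      then have "case_nat r f \<in> D" if "f \<in> X" for f
        using that unfolding D_def mass_join_def by blast
      then show ?thesis by (rule red_0_case_nat)
    qed
    ultimately show ?thesis by blast
  next
    case infinity
    define D where "D = {f. \<forall>g\<in>A. \<exists>c. \<exists>h\<in>B. \<forall>x. eval c (fun_join g f) x = Some (h x)}"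
    have "red n B (mass_join A D)" unfolding infinity red_infinity_iff by (auto simp: D_def mass_join_def)
    moreover have "red 0 D X" if "red n B (mass_join A X)" for X
    proof (rule red_0_recursive[of "\<lambda>f. f", OF recursive_basic(4)])
      show "f \<in> D" if "f \<in> X" for f
        using \<open>red n B (mass_join A X)\<close> that
        unfolding infinity red_infinity_iff D_def mass_join_def by blast
    qed
    ultimately show ?thesis by blast
  qed
  then show ?thesis by (meson red_mass_join_mono red_mono red_refl red_trans zero_le)
qed

section \<open>Degrees\<close>

text \<open>A degree is determined by its upper cone; equalities of degrees are proved below by
  comparing cones.\<close>

lemma equivalent_iff: "equivalent n A B \<longleftrightarrow> (\<forall>X. red n A X \<longleftrightarrow> red n B X)"
  unfolding equivalent_def by (meson red_refl red_trans)

lemma equiv_equiv_rel: "equiv UNIV (equiv_rel n)"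
  by (rule equivI) (auto simp: equiv_rel_def refl_on_def sym_def trans_def equivalent_iff)

lemma deg_eq_iff: "deg n A = deg n B \<longleftrightarrow> equivalent n A B"
  unfolding deg_def using eq_equiv_class_iff[OF equiv_equiv_rel] by (auto simp: equiv_rel_def)

lemma mem_deg_iff: "B \<in> deg n A \<longleftrightarrow> equivalent n A B"
  by (simp add: deg_def equiv_rel_def)

lemma degreesE: assumes "a \<in> degrees n" obtains A where "a = deg n A"
  using assms unfolding degrees_def deg_def by (auto elim: quotientE)

lemma deg_in_degrees: "deg n A \<in> degrees n"
  by (simp add: degrees_def deg_def quotientI)

lemma equivalent_refl: "equivalent n A A"
  by (simp add: equivalent_iff)

lemma deg_le_deg: "deg_le n (deg n A) (deg n B) \<longleftrightarrow> red n A B"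
  unfolding deg_le_def Bex_def mem_deg_iff using equivalent_refl
  by (metis equivalent_def red_trans)

lemma Union_deg: "(\<And>B. equivalent n A B \<Longrightarrow> F B = c) \<Longrightarrow> (\<Union>B\<in>deg n A. F B) = c"
  using equivalent_refl[of n A] by (auto simp: mem_deg_iff)

lemma deg_join_deg: "deg_join n (deg n A) (deg n B) = deg n (mass_join A B)"
  unfolding deg_join_def
  by (intro Union_deg) (simp add: deg_eq_iff equivalent_iff red_mass_join_iff)

text \<open>The hypothesis fixes the upper cone of \<open>D\<close>, and a degree is determined by
  its cone, so the description in \<open>deg_imp\<close> is unique.\<close>

lemma deg_imp_deg:
  assumes "\<And>X. red n D X \<longleftrightarrow> red n B (mass_join A X)"
  shows "deg_imp n (deg n A) (deg n B) = deg n D"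
  unfolding deg_imp_def
proof (rule the_equality)
  have ball: "(\<forall>c\<in>degrees n. P c) \<longleftrightarrow> (\<forall>X. P (deg n X))" for P
    by (metis degreesE deg_in_degrees)
  show "deg n D \<in> degrees n \<and> (\<forall>c\<in>degrees n.
      deg_le n (deg n B) (deg_join n (deg n A) c) \<longleftrightarrow> deg_le n (deg n D) c)"
    unfolding ball by (simp add: deg_in_degrees deg_join_deg deg_le_deg assms)
  fix d assume d: "d \<in> degrees n \<and> (\<forall>c\<in>degrees n.
      deg_le n (deg n B) (deg_join n (deg n A) c) \<longleftrightarrow> deg_le n d c)"
  then obtain D' where D': "d = deg n D'" by (blast elim: degreesE)
  from d show "d = deg n D"
    unfolding ball D' deg_join_deg deg_le_deg deg_eq_iff equivalent_iff assms by blast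
qed

lemma induced_map_deg:
  assumes "induces_map n m u" shows "induced_map n m u (deg n A) = deg m (u A)"
  unfolding induced_map_def
  using assms by (intro Union_deg) (auto simp: induces_map_def deg_eq_iff equivalent_iff)

theorem theorem3p3:
  fixes n :: enat
  shows "\<exists>u :: (nat \<Rightarrow> nat) set \<Rightarrow> (nat \<Rightarrow> nat) set.
           (\<forall>m\<le>n. induces_map n m u \<and>
                   embedding n m (induced_map n m u) \<and>
                   preserves_joins n m (induced_map n m u) \<and>
                   preserves_implications n m (induced_map n m u)) \<and>
           (\<forall>A. equivalent n (u A) A)"
proof -
  obtain u where u: "\<And>A. red n A (u A)" "\<And>A X. red n A X \<Longrightarrow> red 0 (u A) X"
    using uniform_representative[of n] by blast
  \<comment> \<open>The equivalence behind all claims: from left to right pass to level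
    \<open>n\<close> and compose with \<open>red n A (u A)\<close>; from right to left start at
    level 0.\<close>
  have red_u: "red m (u A) X \<longleftrightarrow> red n A X" if "m \<le> n" for m A X
    using u that by (meson red_mono red_trans zero_le)
  have red_uu: "red n A (u B) \<longleftrightarrow> red n A B" for A B
    using u(1)[of B] red_u[of n B B] red_refl red_trans by blast
  \<comment> \<open>\<open>A\<close> and \<open>u A\<close> are equivalent at level
    \<open>n\<close>, hence interchangeable in joins there.\<close>
  have red_join_u: "red n B (mass_join (u A) X) \<longleftrightarrow> red n B (mass_join A X)" for A B X
    using red_mass_join_mono[of n A "u A" X X] red_mass_join_mono[of n "u A" A X X] u(1)[of A] red_u[of n A A]
    by (meson order_refl red_refl red_trans)
  have "induces_map n m u \<and> embedding n m (induced_map n m u) \<and>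
      preserves_joins n m (induced_map n m u) \<and> preserves_implications n m (induced_map n m u)"
    if m: "m \<le> n" for m
  proof -
    have ind: "induces_map n m u"
      by (simp add: induces_map_def equivalent_iff red_u[OF m])
    note map = induced_map_deg[OF ind]
    have "embedding n m (induced_map n m u)"
      unfolding embedding_def
    proof (intro conjI ballI inj_onI subsetI)
      show "b \<in> degrees m" if "b \<in> induced_map n m u ` degrees n" for b
        using that by (auto elim!: degreesE simp: map deg_in_degrees)
      fix a b assume "a \<in> degrees n" "b \<in> degrees n"
      then obtain A B where ab: "a = deg n A" "b = deg n B" by (metis degreesE)
      show "deg_le n a b \<longleftrightarrow> deg_le m (induced_map n m u a) (induced_map n m u b)"
        by (simp add: ab map deg_le_deg red_u[OF m] red_uu)
      show "a = b" if "induced_map n m u a = induced_map n m u b"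
        using that by (simp add: ab map deg_eq_iff equivalent_iff red_u[OF m])
    qed
    moreover have "preserves_joins n m (induced_map n m u)"
      unfolding preserves_joins_def
    proof (intro ballI)
      fix a b assume "a \<in> degrees n" "b \<in> degrees n"
      then obtain A B where ab: "a = deg n A" "b = deg n B" by (metis degreesE)
      show "induced_map n m u (deg_join n a b) = deg_join m (induced_map n m u a) (induced_map n m u b)"
        by (simp add: ab map deg_join_deg deg_eq_iff equivalent_iff red_u[OF m] red_mass_join_iff)
    qed
    moreover have "preserves_implications n m (induced_map n m u)"
      unfolding preserves_implications_def
    proof (intro ballI)
      fix a b assume "a \<in> degrees n" "b \<in> degrees n"
      then obtain A B where ab: "a = deg n A" "b = deg n B" by (metis degreesE)
      obtain D where D: "\<And>X. red n D X \<longleftrightarrow> red n B (mass_join A X)"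
        using implication_exists[of n B A] by blast
      \<comment> \<open>\<open>u D\<close> has the cone required at level \<open>m\<close>: all
        reductions from \<open>u D\<close> and \<open>u B\<close> move to level \<open>n\<close>,
        where \<open>u A\<close> is replaced by \<open>A\<close> in the join.\<close>
      have "deg_imp m (deg m (u A)) (deg m (u B)) = deg m (u D)"
        by (rule deg_imp_deg) (simp add: red_u[OF m] D red_join_u)
      then show "induced_map n m u (deg_imp n a b) = deg_imp m (induced_map n m u a) (induced_map n m u b)"
        by (simp add: ab map deg_imp_deg[OF D])
    qed
    ultimately show ?thesis using ind by blast
  qed
  moreover have "equivalent n (u A) A" for A
    unfolding equivalent_iff using red_u[OF order_refl] by blast
  ultimately show ?thesis by blast
qed

end
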